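(* Let $q\ge 3$, $n\ge1$, $0\le w\le n$, $m=\min\{w,n-w\}$, $L=\{(i,j)\mid 0\le j\le i\le w,\ i-j\le m\}$, and let $\{E_{ij}\}_{(i,j)\in L}$ be the primitive idempotents of the nonbinary Johnson scheme $J_q(w,n)$ on $X=W_w(n,q)$ (indexed as in the context). Suppose $(r,s)\in L$, $(r,s)\neq(0,0)$, with $r\le m$, and let \[ T=\{(i,j)\in L\mid i\le r,\ j\le s\}\setminus\{(0,0)\}. \] Then a subset $Y\subset X$ is a $T$-design in $J_q(w,n)$ if and only if $m_{\mathcal{R},\mathcal{S}}(Y,\omega)$ takes the same value for all $\omega\in\overline{F}^s$ and all subsets $\mathcal{S}\subset\mathcal{R}\subset N$ with $|\mathcal{R}|=r$ and $|\mathcal{S}|=s$.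
   Context: Let $F=\{0,1,\ldots,q-1\}$, $\overline{F}=F\setminus\{0\}$, $N=\{1,\ldots,n\}$. For $x\in F^n$, $\overline{x}=\{i\mid x_i\neq0\}$ and $w_H(x)=|\overline{x}|$; $X=W_w(n,q)=\{x\in F^n\mid w_H(x)=w\}$. With $e(x,y)=|\{i\mid x_i=y_i\neq0\}|$, $n(x,y)=|\{i\mid x_i\ne0,\ y_i\neq0\}|$ and $R_{ij}=\{(x,y)\in X^2\mid e(x,y)=w-i,\ n(x,y)=w-j\}$, $J_q(w,n)=(X,\{R_{ij}\})$ is a symmetric association scheme with Bose--Mesner algebra $\mathfrak{B}$. Indexing of primitive idempotents: give $\overline{F}$ the structure of a multiplicative abelian group with identity $1$, let $\psi_a$ ($a\in\overline F$) be its characters with $\psi_a(b)=\psi_b(a)$, $\psi_a(0)=0$, and $(x,y)=\prod_{i\in\overline x}\psi_{x_i}(y_i)$. Let $w_M(x)=|\{i\mid x_i\ne0,1\}|$, $W_{rs}=\{x\in F^n\mid w_H(x)=r,\ w_M(x)=s\}$, and $C_{rs}\in\mathfrak{B}$ the matrix with $(x,y)$-entry $\sum_{a\in W_{rs}}(a,x)\overline{(a,y)}$ ($x,y\in X$). For $(r,s)\in L$ let $\mathfrak{B}_{rs}=\operatorname{Span}\{C_{kh}\mid (k,h)\in L,\ (k,h)\le (r,s)\text{ lexicographically}\}$; the dimensions increase by one at each step, and $E_{rs}$ is the primitive idempotent first appearing in $\mathfrak{B}_{rs}$. For $T\subset L\setminus\{(0,0)\}$, a subset $Y\subset X$ with characteristic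 vector $\varphi_Y$ is a $T$-design if $E_{ij}\varphi_Y=0$ for all $(i,j)\in T$. For $Y\subset X$, subsets $\mathcal{S}=\{i_1<\cdots<i_s\}\subset\mathcal{R}\subset N$ and $\omega=(\omega_1,\ldots,\omega_s)\in\overline{F}^s$, define $m_{\mathcal{R},\mathcal{S}}(Y,\omega)=|\{y\in Y\mid \mathcal{R}\subset\overline{y},\ y_{i_j}=\omega_j\ (j=1,\ldots,s)\}|$. *)

theory Defs
  imports
    Complex_Main
    "HOL-Library.FuncSet"
    "HOL-Library.Function_Algebras"
    "HOL-Algebra.Group"
begin

text \<open>Words over \<open>F = {..<q}\<close> are functions on the positions \<open>{1..n}\<close>, extensional outside.\<close>

type_synonym word = "nat \<Rightarrow> nat"

definition nonzero_letters :: "nat \<Rightarrow> nat set" where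
  "nonzero_letters q = {1..<q}"

definition words :: "nat \<Rightarrow> nat \<Rightarrow> word set" where
  "words q n = {1..n} \<rightarrow>\<^sub>E {..<q}"

definition supp :: "nat \<Rightarrow> word \<Rightarrow> nat set" where
  "supp n x = {i \<in> {1..n}. x i \<noteq> 0}"

definition wH :: "nat \<Rightarrow> word \<Rightarrow> nat" where
  "wH n x = card (supp n x)"

definition wM :: "nat \<Rightarrow> word \<Rightarrow> nat" where
  "wM n x = card {i \<in> {1..n}. x i \<noteq> 0 \<and> x i \<noteq> 1}"

definition johnson_points :: "nat \<Rightarrow> nat \<Rightarrow> nat \<Rightarrow> word set" where
  "johnson_points q n w = {x \<in> words q n. wH n x = w}"

definition W2 :: "nat \<Rightarrow> nat \<Rightarrow> nat \<Rightarrow> nat \<Rightarrow> word set" where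
  "W2 q n r s = {x \<in> words q n. wH n x = r \<and> wM n x = s}"

definition equal_nonzero :: "nat \<Rightarrow> word \<Rightarrow> word \<Rightarrow> nat" where
  "equal_nonzero n x y = card {i \<in> {1..n}. x i = y i \<and> x i \<noteq> 0}"

definition common_nonzero :: "nat \<Rightarrow> word \<Rightarrow> word \<Rightarrow> nat" where
  "common_nonzero n x y = card {i \<in> {1..n}. x i \<noteq> 0 \<and> y i \<noteq> 0}"

text \<open>\<open>e(x,y) = w - i\<close> and \<open>n(x,y) = w - j\<close> are written additively, since subtraction
  on \<^typ>\<open>nat\<close> truncates.\<close>

definition johnson_rel :: "nat \<Rightarrow> nat \<Rightarrow> nat \<Rightarrow> nat \<Rightarrow> nat \<Rightarrow> (word \<times> word) set" where
  "johnson_rel q n w i j =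
     {(x, y). x \<in> johnson_points q n w \<and> y \<in> johnson_points q n w \<and>
              equal_nonzero n x y + i = w \<and> common_nonzero n x y + j = w}"

definition johnson_index :: "nat \<Rightarrow> nat \<Rightarrow> (nat \<times> nat) set" where
  "johnson_index n w = {(i, j). j \<le> i \<and> i \<le> w \<and> i - j \<le> min w (n - w)}"


text \<open>A complex matrix with rows and columns indexed by a set \<open>X\<close> of words is a function that
  vanishes outside \<open>X \<times> X\<close>, so that equality of such matrices is equality of functions.
  The pointwise product on functions is not the matrix product; the latter is \<open>mat_mult\<close>.\<close>

type_synonym word_mat = "word \<Rightarrow> word \<Rightarrow> complex"

definition mat_scale :: "complex \<Rightarrow> word_mat \<Rightarrow> word_mat" where
  "mat_scale c A = (\<lambda>x y. c * A x y)"

global_interpretation word_mat: vector_space mat_scale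
  by unfold_locales (auto simp: mat_scale_def fun_eq_iff algebra_simps)

definition mat_mult :: "word set \<Rightarrow> word_mat \<Rightarrow> word_mat \<Rightarrow> word_mat" where
  "mat_mult X A B = (\<lambda>x y. \<Sum>z\<in>X. A x z * B z y)"

definition mat_vec :: "word set \<Rightarrow> word_mat \<Rightarrow> (word \<Rightarrow> complex) \<Rightarrow> word \<Rightarrow> complex" where
  "mat_vec X A v = (\<lambda>x. \<Sum>y\<in>X. A x y * v y)"

definition adjacency :: "(word \<times> word) set \<Rightarrow> word_mat" where
  "adjacency R = (\<lambda>x y. if (x, y) \<in> R then 1 else 0)"

text \<open>Indices \<open>(i, j)\<close> with empty relation contribute only the zero matrix.\<close>

definition bose_mesner :: "nat \<Rightarrow> nat \<Rightarrow> nat \<Rightarrow> word_mat set" where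
  "bose_mesner q n w = word_mat.span {adjacency (johnson_rel q n w i j) | i j. True}"

definition primitive_idempotent :: "word set \<Rightarrow> word_mat set \<Rightarrow> word_mat \<Rightarrow> bool" where
  "primitive_idempotent X B E \<longleftrightarrow>
     E \<in> B \<and> E \<noteq> 0 \<and> mat_mult X E E = E \<and>
     \<not> (\<exists>P\<in>B. \<exists>Q\<in>B. P \<noteq> 0 \<and> Q \<noteq> 0 \<and> mat_mult X P P = P \<and> mat_mult X Q Q = Q \<and>
          mat_mult X P Q = 0 \<and> mat_mult X Q P = 0 \<and> E = P + Q)"


text \<open>Complex characters of a group of letters, extended by zero outside the group; in
  particular \<open>\<chi> 0 = 0\<close> when the carrier is \<open>nonzero_letters q\<close>.\<close>

definition group_characters :: "nat monoid \<Rightarrow> (nat \<Rightarrow> complex) set" where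
  "group_characters G =
     {\<chi>. (\<forall>a\<in>carrier G. \<forall>b\<in>carrier G. \<chi> (a \<otimes>\<^bsub>G\<^esub> b) = \<chi> a * \<chi> b) \<and>
         (\<forall>a\<in>carrier G. \<chi> a \<noteq> 0) \<and>
         (\<forall>a. a \<notin> carrier G \<longrightarrow> \<chi> a = 0)}"

definition symmetric_characters :: "nat \<Rightarrow> nat monoid \<Rightarrow> (nat \<Rightarrow> nat \<Rightarrow> complex) \<Rightarrow> bool" where
  "symmetric_characters q G \<psi> \<longleftrightarrow>
     comm_group G \<and> carrier G = nonzero_letters q \<and> \<one>\<^bsub>G\<^esub> = 1 \<and>
     bij_betw \<psi> (nonzero_letters q) (group_characters G) \<and>
     (\<forall>a\<in>nonzero_letters q. \<forall>b\<in>nonzero_letters q. \<psi> a b = \<psi> b a)"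

definition word_pairing :: "nat \<Rightarrow> (nat \<Rightarrow> nat \<Rightarrow> complex) \<Rightarrow> word \<Rightarrow> word \<Rightarrow> complex" where
  "word_pairing n \<psi> x y = (\<Prod>i\<in>supp n x. \<psi> (x i) (y i))"

definition C_mat ::
  "nat \<Rightarrow> nat \<Rightarrow> nat \<Rightarrow> (nat \<Rightarrow> nat \<Rightarrow> complex) \<Rightarrow> nat \<Rightarrow> nat \<Rightarrow> word_mat" where
  "C_mat q n w \<psi> r s = (\<lambda>x y.
     if x \<in> johnson_points q n w \<and> y \<in> johnson_points q n w
     then \<Sum>a\<in>W2 q n r s. word_pairing n \<psi> a x * cnj (word_pairing n \<psi> a y)
     else 0)"

definition lex_less :: "nat \<times> nat \<Rightarrow> nat \<times> nat \<Rightarrow> bool" where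
  "lex_less p p' \<longleftrightarrow> fst p < fst p' \<or> fst p = fst p' \<and> snd p < snd p'"

definition B_filtration ::
  "nat \<Rightarrow> nat \<Rightarrow> nat \<Rightarrow> (nat \<Rightarrow> nat \<Rightarrow> complex) \<Rightarrow> nat \<Rightarrow> nat \<Rightarrow> word_mat set" where
  "B_filtration q n w \<psi> r s =
     word_mat.span {C_mat q n w \<psi> k h | k h.
       (k, h) \<in> johnson_index n w \<and> (lex_less (k, h) (r, s) \<or> (k, h) = (r, s))}"

text \<open>\<open>E r s\<close> is the primitive idempotent of the Bose--Mesner algebra that lies in the
  \<open>(r, s)\<close> member of the filtration but in no earlier member.\<close>

definition indexed_idempotents ::
  "nat \<Rightarrow> nat \<Rightarrow> nat \<Rightarrow> (nat \<Rightarrow> nat \<Rightarrow> complex) \<Rightarrow> (nat \<Rightarrow> nat \<Rightarrow> word_mat) \<Rightarrow> bool" where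
  "indexed_idempotents q n w \<psi> E \<longleftrightarrow>
     (\<forall>(r, s) \<in> johnson_index n w.
        primitive_idempotent (johnson_points q n w) (bose_mesner q n w) (E r s) \<and>
        E r s \<in> B_filtration q n w \<psi> r s \<and>
        (\<forall>(k, h) \<in> johnson_index n w. lex_less (k, h) (r, s) \<longrightarrow>
           E r s \<notin> B_filtration q n w \<psi> k h))"

definition is_design ::
  "nat \<Rightarrow> nat \<Rightarrow> nat \<Rightarrow> (nat \<Rightarrow> nat \<Rightarrow> word_mat) \<Rightarrow> (nat \<times> nat) set \<Rightarrow> word set \<Rightarrow> bool" where
  "is_design q n w E T Y \<longleftrightarrow>
     T \<subseteq> johnson_index n w - {(0, 0)} \<and> Y \<subseteq> johnson_points q n w \<and>
     (\<forall>(i, j)\<in>T. \<forall>x\<in>johnson_points q n w.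
        mat_vec (johnson_points q n w) (E i j) (\<lambda>y. if y \<in> Y then 1 else 0) x = 0)"

text \<open>The \<open>j\<close>-th smallest element of \<open>S\<close> is matched with the \<open>j\<close>-th entry of \<open>\<omega>\<close>
  (both counted from zero).\<close>

definition m_count :: "nat \<Rightarrow> nat set \<Rightarrow> nat set \<Rightarrow> word set \<Rightarrow> nat list \<Rightarrow> nat" where
  "m_count n R S Y \<omega> =
     card {y \<in> Y. R \<subseteq> supp n y \<and> (\<forall>j < card S. y (sorted_list_of_set S ! j) = \<omega> ! j)}"

end

theory Submission
  imports Defs "HOL-Combinatorics.Permutations"
begin

text \<open>For a word \<open>a\<close> let \<open>f\<^sub>a = (a, \<cdot>)\<close>, so that \<open>C r s\<close> is the Gram sum of the \<open>f\<^sub>a\<close> over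
  \<open>a \<in> W\<^sub>r\<^sub>s\<close>. Two such functions are orthogonal unless they carry nontrivial characters at the same
  positions, hence \<open>C k h\<close> and \<open>C k' h'\<close> multiply to zero for \<open>h \<noteq> h'\<close>. A primitive idempotent
  \<open>E i j\<close> is therefore \<open>\<alpha> C i j\<close> plus a combination of the \<open>C k j\<close> with \<open>k < i\<close>, where
  \<open>\<alpha> \<noteq> 0\<close> because \<open>E i j\<close> is new in its filtration step. By this triangularity the matrices
  \<open>E j j, \<dots>, E r j\<close> kill a vector \<open>v\<close> iff \<open>C j j, \<dots>, C r j\<close> do, which by positivity and by
  summing over one-letter extensions of words just says that \<open>v\<close> is orthogonal to \<open>f\<^sub>a\<close> for all
  \<open>a \<in> W\<^sub>r\<^sub>j\<close>; no spectral theory of the scheme enters. For \<open>j = 0\<close> the excluded index \<open>(0, 0)\<close>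
  weakens orthogonality to constancy of the inner products. Fourier analysis on the words
  \<open>\<omega>\<close> identifies these conditions with the constancy of the numbers \<open>m\<^sub>R\<^sub>,\<^sub>S(Y, \<omega>)\<close>.\<close>

section \<open>Matrices indexed by words\<close>

lemma sum_matrix_apply: "(\<Sum>p\<in>I. F p) x y = (\<Sum>p\<in>I. F p x y)" for F :: "'i \<Rightarrow> word_mat"
  by (induction I rule: infinite_finite_induct) auto

text \<open>Equal fibre sizes mean equal image multisets, hence a permutation matching the two
  functions. Later it carries one pair of points, or one support, to another.\<close>

lemma exists_permutation_matching:
  assumes "finite A" "\<And>v. card {i \<in> A. f i = v} = card {i \<in> A. g i = v}"
  obtains p where "p permutes A" "\<And>i. i \<in> A \<Longrightarrow> f i = g (p i)"
proof -
  have "image_mset f (mset_set A) = image_mset g (mset_set A)"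
    using assms by (intro multiset_eqI) (simp add: count_image_mset vimage_def Int_def conj_commute)
  then show ?thesis
    using image_mset_eq_implies_permutes[OF assms(1)] that by metis
qed

definition adjoint :: "word_mat \<Rightarrow> word_mat" where
  "adjoint A = (\<lambda>x y. cnj (A y x))"

lemma mat_mult_add_left: "mat_mult X (A + B) D = mat_mult X A D + mat_mult X B D"
  and mat_mult_add_right: "mat_mult X D (A + B) = mat_mult X D A + mat_mult X D B"
  and mat_mult_diff_left: "mat_mult X (A - B) D = mat_mult X A D - mat_mult X B D"
  and mat_mult_diff_right: "mat_mult X D (A - B) = mat_mult X D A - mat_mult X D B"
  and mat_mult_scale_left: "mat_mult X (mat_scale c A) D = mat_scale c (mat_mult X A D)"
  and mat_mult_scale_right: "mat_mult X D (mat_scale c A) = mat_scale c (mat_mult X D A)"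
  and mat_mult_zero_left: "mat_mult X 0 D = 0"
  and mat_mult_zero_right: "mat_mult X D 0 = 0"
  by (auto simp: mat_mult_def mat_scale_def fun_eq_iff algebra_simps sum.distrib sum_subtractf sum_distrib_left)

lemma mat_mult_assoc: "mat_mult X (mat_mult X A B) D = mat_mult X A (mat_mult X B D)"
proof (intro ext)
  fix x y
  have "(\<Sum>z\<in>X. (\<Sum>v\<in>X. A x v * B v z) * D z y) = (\<Sum>v\<in>X. A x v * (\<Sum>z\<in>X. B v z * D z y))"
    unfolding sum_distrib_left sum_distrib_right by (subst sum.swap) (simp only: mult.assoc)
  then show "mat_mult X (mat_mult X A B) D x y = mat_mult X A (mat_mult X B D) x y"
    by (simp add: mat_mult_def)
qed

lemma adjoint_add: "adjoint (A + B) = adjoint A + adjoint B"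
  and adjoint_diff: "adjoint (A - B) = adjoint A - adjoint B"
  and adjoint_scale: "adjoint (mat_scale c A) = mat_scale (cnj c) (adjoint A)"
  and adjoint_zero: "adjoint 0 = 0"
  and adjoint_mult: "adjoint (mat_mult X A B) = mat_mult X (adjoint B) (adjoint A)"
  by (auto simp: adjoint_def mat_mult_def mat_scale_def fun_eq_iff mult.commute)

text \<open>The diagonal entry of the product at \<open>y\<close> is the squared norm of column
  \<open>y\<close> of \<open>U\<close>. Only rows \<open>x \<in> X\<close> are reached, because
  products sum over \<open>X\<close>.\<close>

lemma adjoint_mult_self_eq_0:
  assumes "finite X" "mat_mult X (adjoint U) U = 0" "x \<in> X"
  shows "U x y = 0"
proof -
  have "of_real (\<Sum>z\<in>X. (norm (U z y))\<^sup>2) = mat_mult X (adjoint U) U y y"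
    unfolding of_real_sum mat_mult_def adjoint_def complex_norm_square by (simp only: mult.commute)
  also have "\<dots> = 0"
    using assms(2) by simp
  finally have "(\<Sum>z\<in>X. (norm (U z y))\<^sup>2) = 0"
    by (simp only: of_real_eq_0_iff)
  then show ?thesis
    using assms(1,3) by (simp add: sum_nonneg_eq_0_iff)
qed

lemma mat_vec_add: "mat_vec X (A + B) v x = mat_vec X A v x + mat_vec X B v x"
  and mat_vec_zero: "mat_vec X 0 v x = 0"
  and mat_vec_scale: "mat_vec X (mat_scale c A) v x = c * mat_vec X A v x"
  and mat_vec_vec_diff_scale: "mat_vec X A (\<lambda>y. v y - c * u y) x = mat_vec X A v x - c * mat_vec X A u x"
  by (auto simp: mat_vec_def mat_scale_def algebra_simps sum.distrib sum_subtractf sum_distrib_left)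

lemma mat_vec_span_eq_0:
  assumes "A \<in> word_mat.span S" "\<And>B. B \<in> S \<Longrightarrow> mat_vec X B v x = 0"
  shows "mat_vec X A v x = 0"
proof -
  have "word_mat.span S \<subseteq> {A. mat_vec X A v x = 0}"
    using assms(2)
    by (intro word_mat.span_minimal)
      (auto simp: word_mat.subspace_def mat_vec_add mat_vec_scale mat_vec_zero)
  then show ?thesis using assms(1) by auto
qed

lemma mat_mult_span_eq_0:
  assumes "A \<in> word_mat.span S" "B \<in> word_mat.span S'"
    and "\<And>a b. a \<in> S \<Longrightarrow> b \<in> S' \<Longrightarrow> mat_mult X a b = 0"
  shows "mat_mult X A B = 0"
proof -
  have "word_mat.span S' \<subseteq> {B. mat_mult X a B = 0}" if "a \<in> S" for a
    using assms(3)[OF that]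
    by (intro word_mat.span_minimal)
      (auto simp: word_mat.subspace_def mat_mult_zero_right mat_mult_add_right mat_mult_scale_right)
  then have "word_mat.span S \<subseteq> {A. mat_mult X A B = 0}"
    using assms(2)
    by (intro word_mat.span_minimal)
      (auto simp: word_mat.subspace_def mat_mult_zero_left mat_mult_add_left mat_mult_scale_left)
  then show ?thesis using assms(1) by auto
qed

section \<open>Characters and the pairing of words\<close>

locale nonbinary_johnson =
  fixes q n w :: nat and G :: "nat monoid" and \<psi> :: "nat \<Rightarrow> nat \<Rightarrow> complex"
  assumes q2: "q \<ge> 2" and wn: "w \<le> n" and sym_chars: "symmetric_characters q G \<psi>"
begin

abbreviation X where "X \<equiv> johnson_points q n w"
abbreviation letters where "letters \<equiv> nonzero_letters q"
abbreviation pairing where "pairing \<equiv> word_pairing n \<psi>"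
abbreviation C where "C \<equiv> C_mat q n w \<psi>"
abbreviation W where "W \<equiv> W2 q n"
text \<open>Since \<open>\<psi> 1\<close> is the trivial character, these are the positions where
  \<open>pairing a\<close> carries a nontrivial one; \<open>wM\<close> counts them.\<close>

abbreviation nontriv where "nontriv a \<equiv> {i \<in> {1..n}. a i \<noteq> 0 \<and> a i \<noteq> 1}"

lemma comm_group_G: "comm_group G"
  and carrier_G: "carrier G = letters"
  and one_G: "\<one>\<^bsub>G\<^esub> = 1"
  and bij_chars: "bij_betw \<psi> letters (group_characters G)"
  and char_sym: "a \<in> letters \<Longrightarrow> b \<in> letters \<Longrightarrow> \<psi> a b = \<psi> b a"
  using sym_chars by (auto simp: symmetric_characters_def)

sublocale G: comm_group G
  by (rule comm_group_G)

lemma letters_nonzero [simp]: "0 \<notin> letters"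
  by (simp add: nonzero_letters_def)

lemma one_letter [simp]: "Suc 0 \<in> letters"
  using q2 by (simp add: nonzero_letters_def)

lemma finite_letters [simp]: "finite letters"
  by (simp add: nonzero_letters_def)

lemma card_letters: "card letters = q - 1"
  by (simp add: nonzero_letters_def)

lemma mult_letter: "g \<in> letters \<Longrightarrow> a \<in> letters \<Longrightarrow> g \<otimes>\<^bsub>G\<^esub> a \<in> letters"
  using G.m_closed carrier_G by simp

lemma bij_mult_letter:
  assumes "g \<in> letters"
  shows "bij_betw (\<lambda>a. g \<otimes>\<^bsub>G\<^esub> a) letters letters"
  using G.inj_on_cmult[of g] G.surj_const_mult[of g] assms
  by (simp add: bij_betw_def carrier_G)

lemma char_in: "a \<in> letters \<Longrightarrow> \<psi> a \<in> group_characters G"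
  using bij_chars by (auto simp: bij_betw_def)

lemma char_mult: "a \<in> letters \<Longrightarrow> x \<in> letters \<Longrightarrow> y \<in> letters \<Longrightarrow>
    \<psi> a (x \<otimes>\<^bsub>G\<^esub> y) = \<psi> a x * \<psi> a y"
  and char_nonzero: "a \<in> letters \<Longrightarrow> x \<in> letters \<Longrightarrow> \<psi> a x \<noteq> 0"
  and char_outside: "a \<in> letters \<Longrightarrow> x \<notin> letters \<Longrightarrow> \<psi> a x = 0"
  using char_in[of a] by (auto simp: group_characters_def carrier_G)

lemma char_at_0 [simp]: "a \<in> letters \<Longrightarrow> \<psi> a 0 = 0"
  by (simp add: char_outside)

lemma char_at_1: "a \<in> letters \<Longrightarrow> \<psi> a (Suc 0) = 1"
proof -
  assume a: "a \<in> letters"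
  have "1 \<otimes>\<^bsub>G\<^esub> 1 = 1"
    using G.r_one[OF G.one_closed] by (simp only: one_G)
  then show ?thesis
    using char_mult[of a 1 1] char_nonzero[of a 1] a by simp
qed

text \<open>Symmetry of \<open>\<psi>\<close> turns the value 1 of every character at the identity
  into triviality of the character indexed by the identity.\<close>

lemma trivial_char [simp]: "x \<in> letters \<Longrightarrow> \<psi> (Suc 0) x = 1"
  by (metis char_at_1 char_sym one_letter)

lemma char_eqI:
  assumes "a \<in> letters" "b \<in> letters" "\<And>x. x \<in> letters \<Longrightarrow> \<psi> a x = \<psi> b x"
  shows "a = b"
proof -
  have "\<psi> a = \<psi> b"
    using assms char_outside by (metis ext)
  then show ?thesis
    using bij_chars assms by (auto simp: bij_betw_def inj_on_def)
qed

text \<open>Translation by \<open>g\<close> permutes the letters and multiplies the product of all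
  values of \<open>\<psi> a\<close> by \<open>\<psi> a g ^ card letters\<close>. That product is
  nonzero, so \<open>\<psi> a g\<close> is a root of unity.\<close>

lemma norm_char:
  assumes "a \<in> letters" "g \<in> letters"
  shows "norm (\<psi> a g) = 1"
proof -
  have "(\<Prod>x\<in>letters. \<psi> a x) = (\<Prod>x\<in>letters. \<psi> a (g \<otimes>\<^bsub>G\<^esub> x))"
    using prod.reindex_bij_betw[OF bij_mult_letter[OF assms(2)], of "\<psi> a"] by simp
  also have "\<dots> = \<psi> a g ^ card letters * (\<Prod>x\<in>letters. \<psi> a x)"
    using assms by (simp add: char_mult prod.distrib)
  finally have "\<psi> a g ^ card letters = 1"
    using assms by (simp add: char_nonzero)
  then show ?thesis
    using power_eq_1_iff[of "\<psi> a g" "card letters"] assms by auto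
qed

lemma char_cnj: "a \<in> letters \<Longrightarrow> g \<in> letters \<Longrightarrow> \<psi> a g * cnj (\<psi> a g) = 1"
  using norm_char[of a g] by (metis complex_norm_square of_real_1 power_one)

text \<open>Translating the summation variable by \<open>g\<close> multiplies the sum by
  \<open>\<psi> a g * cnj (\<psi> b g)\<close>, and for \<open>a \<noteq> b\<close> some \<open>g\<close> makes this factor different from 1.\<close>

lemma char_orthogonal:
  assumes a: "a \<in> letters" and b: "b \<in> letters"
  shows "(\<Sum>x\<in>letters. \<psi> a x * cnj (\<psi> b x)) = (if a = b then of_nat (q - 1) else 0)"
proof (cases "a = b")
  case True
  then show ?thesis
    using a by (simp add: char_cnj card_letters)
next
  case False
  then obtain g where g: "g \<in> letters" "\<psi> a g \<noteq> \<psi> b g"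
    using char_eqI a b by blast
  let ?S = "\<Sum>x\<in>letters. \<psi> a x * cnj (\<psi> b x)"
  let ?c = "\<psi> a g * cnj (\<psi> b g)"
  have "?S = (\<Sum>x\<in>letters. \<psi> a (g \<otimes>\<^bsub>G\<^esub> x) * cnj (\<psi> b (g \<otimes>\<^bsub>G\<^esub> x)))"
    using sum.reindex_bij_betw[OF bij_mult_letter[OF g(1)], of "\<lambda>x. \<psi> a x * cnj (\<psi> b x)"] by simp
  also have "\<dots> = ?c * ?S"
    using a b g by (simp add: char_mult sum_distrib_left mult_ac)
  finally have "?S * (1 - ?c) = 0"
    by (simp add: algebra_simps)
  moreover have "?c \<noteq> 1"
  proof
    assume "?c = 1"
    then have "\<psi> b g = ?c * \<psi> b g" by simp
    also have "\<dots> = \<psi> a g * (\<psi> b g * cnj (\<psi> b g))" by (simp only: mult_ac)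
    finally show False using g b by (simp add: char_cnj)
  qed
  ultimately show ?thesis
    using False by simp
qed

lemma sum_char:
  assumes "a \<in> letters"
  shows "(\<Sum>x\<in>letters. \<psi> a x) = (if a = 1 then of_nat (q - 1) else 0)"
  using char_orthogonal[OF assms one_letter] by simp

text \<open>Symmetry of \<open>\<psi>\<close> exchanges characters and letters, so the second
  orthogonality relation is the first one read with the roles swapped.\<close>

lemma char_orthogonal_dual:
  assumes "x \<in> letters" "y \<in> letters"
  shows "(\<Sum>a\<in>letters. \<psi> a x * cnj (\<psi> a y)) = (if x = y then of_nat (q - 1) else 0)"
  using char_orthogonal[OF assms] assms by (simp add: char_sym cong: sum.cong)

section \<open>Words, supports and orthogonality of the pairings\<close>

lemma finite_words [simp]: "finite (words q n)"
  by (simp add: words_def finite_PiE)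

lemma finite_X [simp]: "finite X"
  by (simp add: johnson_points_def)

lemma finite_W [simp]: "finite (W k h)"
  by (simp add: W2_def)

lemma finite_supp [simp]: "finite (supp n x)"
  by (simp add: supp_def)

lemma word_letter: "x \<in> words q n \<Longrightarrow> i \<in> supp n x \<Longrightarrow> x i \<in> letters"
  by (auto simp: words_def supp_def nonzero_letters_def PiE_def Pi_def)

lemma in_X: "x \<in> X \<longleftrightarrow> x \<in> words q n \<and> card (supp n x) = w"
  by (simp add: johnson_points_def wH_def)

lemma in_W: "a \<in> W k h \<longleftrightarrow> a \<in> words q n \<and> card (supp n a) = k \<and> card (nontriv a) = h"
  by (simp add: W2_def wH_def wM_def)

lemma pairing_eq_0:
  assumes "a \<in> words q n" "\<not> supp n a \<subseteq> supp n x"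
  shows "pairing a x = 0"
proof -
  obtain i where i: "i \<in> supp n a" "x i = 0"
    using assms(2) by (auto simp: supp_def)
  then have "\<psi> (a i) (x i) = 0"
    using word_letter[OF assms(1)] by simp
  then show ?thesis
    using i unfolding word_pairing_def by (intro prod_zero bexI[of _ i]) auto
qed

lemma pairing_permute:
  assumes "p permutes {1..n}"
  shows "pairing (a \<circ> p) (x \<circ> p) = pairing a x"
proof -
  have "bij_betw p (supp n (a \<circ> p)) (supp n a)"
  proof (rule bij_betw_imageI)
    show "inj_on p (supp n (a \<circ> p))"
      using permutes_inj_on[OF assms] .
    show "p ` supp n (a \<circ> p) = supp n a"
    proof (intro equalityI subsetI)
      fix i assume "i \<in> supp n a"
      moreover from this obtain j where "j \<in> {1..n}" "i = p j"
        using permutes_image[OF assms] unfolding supp_def by blast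
      ultimately show "i \<in> p ` supp n (a \<circ> p)"
        by (simp add: supp_def)
    qed (use permutes_in_image[OF assms] in \<open>auto simp: supp_def\<close>)
  qed
  from prod.reindex_bij_betw[OF this, of "\<lambda>i. \<psi> (a i) (x i)"] show ?thesis
    by (simp add: word_pairing_def)
qed

text \<open>With the index set \<open>{1..n}\<close> independent of \<open>a\<close>, the factor at
  one position can be split off and sums over words can be distributed over positions.\<close>

lemma pairing_eq_prod:
  "pairing a x = (\<Prod>i\<in>{1..n}. if a i = 0 then 1 else \<psi> (a i) (x i))"
  unfolding word_pairing_def supp_def
  by (subst prod.inter_filter) (auto intro!: prod.cong)

text \<open>Multiplying the letter at a position where only \<open>a\<close> carries a nontrivial character
  permutes the points, leaves \<open>pairing b\<close> unchanged and scales \<open>pairing a\<close>.\<close>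

lemma pairing_orthogonal_aux:
  assumes a: "a \<in> words q n" and b: "b \<in> words q n"
    and i: "i \<in> nontriv a" "i \<notin> nontriv b"
  shows "(\<Sum>z\<in>X. pairing a z * cnj (pairing b z)) = 0"
proof -
  have ai: "a i \<in> letters" "a i \<noteq> 1"
    using word_letter[OF a] i by (auto simp: supp_def)
  \<comment> \<open>\<open>\<psi> (a i)\<close> differs from the trivial character because
    \<open>a i \<noteq> 1\<close>.\<close>
  obtain g where g: "g \<in> letters" "\<psi> (a i) g \<noteq> 1"
    using char_eqI[OF ai(1) one_letter] ai by auto
  \<comment> \<open>A zero at position \<open>i\<close> stays zero, so supports are preserved and
    \<open>X\<close> is mapped to itself.\<close>
  define \<tau> where "\<tau> z = z(i := if z i = 0 then 0 else g \<otimes>\<^bsub>G\<^esub> z i)" for z :: word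
  have gz: "g \<otimes>\<^bsub>G\<^esub> z i \<in> letters" if "z \<in> X" "z i \<noteq> 0" for z
    using that g i word_letter[of z i] by (auto simp: in_X supp_def intro!: mult_letter)
  have gz0: "g \<otimes>\<^bsub>G\<^esub> z i \<noteq> 0" if "z \<in> X" "z i \<noteq> 0" for z
    using gz[OF that] by (metis letters_nonzero)
  have mem: "\<tau> z \<in> X" if z: "z \<in> X" for z
  proof -
    have "supp n (\<tau> z) = supp n z"
      using gz0[OF z] by (auto simp: supp_def \<tau>_def)
    moreover have "\<tau> z \<in> words q n"
      using z i gz[OF z] by (auto simp: in_X words_def \<tau>_def PiE_def Pi_def extensional_def nonzero_letters_def)
    ultimately show ?thesis using z by (simp add: in_X)
  qed
  have "inj_on \<tau> X"
  proof (rule inj_onI)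
    fix y z assume yz: "y \<in> X" "z \<in> X" "\<tau> y = \<tau> z"
    have "y i = z i"
    proof (cases "y i = 0 \<or> z i = 0")
      case True
      then show ?thesis
        using fun_cong[OF yz(3), of i] gz0[OF yz(1)] gz0[OF yz(2)] by (auto simp: \<tau>_def split: if_splits)
    next
      case False
      then have "y i \<in> letters" "z i \<in> letters"
        using yz i word_letter[of y i] word_letter[of z i] by (auto simp: in_X supp_def)
      moreover have "g \<otimes>\<^bsub>G\<^esub> y i = g \<otimes>\<^bsub>G\<^esub> z i"
        using False fun_cong[OF yz(3), of i] by (simp add: \<tau>_def)
      ultimately show ?thesis
        using bij_mult_letter[OF g(1)] by (auto simp: bij_betw_def inj_on_def)
    qed
    moreover have "y j = z j" if "j \<noteq> i" for j
      using fun_cong[OF yz(3), of j] that by (simp add: \<tau>_def)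
    ultimately show "y = z" by (metis ext)
  qed
  then have bij: "bij_betw \<tau> X X"
    using mem by (metis bij_betw_def endo_inj_surj finite_X image_subsetI)
  have in1: "i \<in> {1..n}" using i by simp
  have pa: "pairing a (\<tau> z) = \<psi> (a i) g * pairing a z" if z: "z \<in> X" for z
  proof -
    have "\<psi> (a i) (\<tau> z i) = \<psi> (a i) g * \<psi> (a i) (z i)"
      using ai g z i word_letter[of z i] by (auto simp: \<tau>_def char_mult in_X supp_def)
    moreover have "(\<Prod>j\<in>{1..n}-{i}. if a j = 0 then 1 else \<psi> (a j) (\<tau> z j)) =
        (\<Prod>j\<in>{1..n}-{i}. if a j = 0 then 1 else \<psi> (a j) (z j))"
      by (intro prod.cong) (auto simp: \<tau>_def)
    moreover have "a i \<noteq> 0"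
      using i by simp
    ultimately show ?thesis
      unfolding pairing_eq_prod prod.remove[OF finite_atLeastAtMost in1]
      by (simp only: if_False mult_ac)
  qed
  have pb: "pairing b (\<tau> z) = pairing b z" if z: "z \<in> X" for z
    unfolding pairing_eq_prod
  proof (intro prod.cong refl)
    fix j assume j: "j \<in> {1..n}"
    show "(if b j = 0 then 1 else \<psi> (b j) (\<tau> z j)) = (if b j = 0 then 1 else \<psi> (b j) (z j))"
    proof (cases "j = i \<and> z i \<noteq> 0")
      case True
      then have "z i \<in> letters"
        using z i word_letter[of z i] by (auto simp: in_X supp_def)
      then show ?thesis
        using True i gz[OF z] by (auto simp: \<tau>_def)
    qed (auto simp: \<tau>_def)
  qed
  let ?S = "\<Sum>z\<in>X. pairing a z * cnj (pairing b z)"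
  have "?S = (\<Sum>z\<in>X. pairing a (\<tau> z) * cnj (pairing b (\<tau> z)))"
    using sum.reindex_bij_betw[OF bij, of "\<lambda>z. pairing a z * cnj (pairing b z)"] by simp
  also have "\<dots> = \<psi> (a i) g * ?S"
    by (simp add: pa pb sum_distrib_left mult_ac)
  finally show ?thesis
    using g(2) by simp
qed

text \<open>Some position is nontrivial for exactly one of the words. If that word is
  \<open>b\<close>, conjugating the sum swaps the roles.\<close>

lemma pairing_orthogonal:
  assumes a: "a \<in> words q n" and b: "b \<in> words q n" and ne: "nontriv a \<noteq> nontriv b"
  shows "(\<Sum>z\<in>X. pairing a z * cnj (pairing b z)) = 0"
proof -
  consider i where "i \<in> nontriv a" "i \<notin> nontriv b" | i where "i \<in> nontriv b" "i \<notin> nontriv a"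
    using ne by blast
  then show ?thesis
  proof cases
    case 1
    then show ?thesis using pairing_orthogonal_aux[OF a b] by blast
  next
    case 2
    then have "(\<Sum>z\<in>X. pairing b z * cnj (pairing a z)) = 0"
      using pairing_orthogonal_aux[OF b a] by blast
    then have "cnj (\<Sum>z\<in>X. pairing b z * cnj (pairing a z)) = 0"
      by simp
    then show ?thesis by (simp add: mult.commute)
  qed
qed

text \<open>Summing over the middle point \<open>z\<close> first gives the inner product of
  \<open>pairing b\<close> with \<open>pairing a\<close>. The words have \<open>h'\<close> and
  \<open>h\<close> nontrivial positions, so these position sets differ.\<close>

lemma C_mult_C:
  assumes "h \<noteq> h'"
  shows "mat_mult X (C k h) (C k' h') = 0"
proof (intro ext)
  fix x y
  show "mat_mult X (C k h) (C k' h') x y = 0 x y"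
  proof (cases "x \<in> X \<and> y \<in> X")
    case True
    have "mat_mult X (C k h) (C k' h') x y =
      (\<Sum>z\<in>X. \<Sum>a\<in>W k h. \<Sum>b\<in>W k' h'. (pairing a x * cnj (pairing b y)) * (pairing b z * cnj (pairing a z)))"
      using True unfolding mat_mult_def C_mat_def
      by (simp only: if_True simp_thms sum_product cong: sum.cong) (simp only: mult_ac)
    also have "\<dots> = (\<Sum>a\<in>W k h. \<Sum>b\<in>W k' h'. \<Sum>z\<in>X. (pairing a x * cnj (pairing b y)) * (pairing b z * cnj (pairing a z)))"
      by (subst sum.swap, rule sum.cong[OF refl], rule sum.swap)
    also have "\<dots> = 0"
    proof (rule sum.neutral, rule ballI, rule sum.neutral, rule ballI)
      fix a b assume ab: "a \<in> W k h" "b \<in> W k' h'"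
      then have "nontriv b \<noteq> nontriv a"
        using assms unfolding in_W by metis
      then have "(\<Sum>z\<in>X. pairing b z * cnj (pairing a z)) = 0"
        using ab by (intro pairing_orthogonal) (auto simp: in_W)
      then show "(\<Sum>z\<in>X. (pairing a x * cnj (pairing b y)) * (pairing b z * cnj (pairing a z))) = 0"
        by (metis mult_zero_right sum_distrib_left)
    qed
    finally show ?thesis by simp
  qed (auto simp: mat_mult_def C_mat_def)
qed

section \<open>The matrices \<open>C k h\<close> lie in the Bose--Mesner algebra\<close>

lemma bose_mesnerI:
  assumes supp: "\<And>x y. x \<notin> X \<or> y \<notin> X \<Longrightarrow> A x y = 0"
    and const: "\<And>x y x' y'. \<lbrakk>x \<in> X; y \<in> X; x' \<in> X; y' \<in> X;
      equal_nonzero n x y = equal_nonzero n x' y'; common_nonzero n x y = common_nonzero n x' y'\<rbrakk>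
      \<Longrightarrow> A x y = A x' y'"
  shows "A \<in> bose_mesner q n w"
proof -
  have "\<exists>c. \<forall>x\<in>X. \<forall>y\<in>X. A x y = c (equal_nonzero n x y) (common_nonzero n x y)"
  proof -
    \<comment> \<open>The value of \<open>A\<close> at any pair realising \<open>(e, f)\<close>. If
      no pair does, the value is arbitrary and the corresponding adjacency matrix is zero.\<close>
    define c where "c e f = (SOME v. \<exists>x\<in>X. \<exists>y\<in>X. equal_nonzero n x y = e \<and>
        common_nonzero n x y = f \<and> v = A x y)" for e f
    have "A x y = c (equal_nonzero n x y) (common_nonzero n x y)" if xy: "x \<in> X" "y \<in> X" for x y
    proof -
      have "\<exists>x'\<in>X. \<exists>y'\<in>X. equal_nonzero n x' y' = equal_nonzero n x y \<and>
          common_nonzero n x' y' = common_nonzero n x y \<and>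
          c (equal_nonzero n x y) (common_nonzero n x y) = A x' y'"
        unfolding c_def by (rule someI_ex) (use xy in blast)
      then show ?thesis using const xy by metis
    qed
    then show ?thesis by blast
  qed
  then obtain c where c: "\<And>x y. x \<in> X \<Longrightarrow> y \<in> X \<Longrightarrow> A x y = c (equal_nonzero n x y) (common_nonzero n x y)"
    by blast
  let ?I = "{..w} \<times> {..w}"
  let ?F = "\<lambda>p. mat_scale (c (w - fst p) (w - snd p)) (adjacency (johnson_rel q n w (fst p) (snd p)))"
  have "A = (\<Sum>p\<in>?I. ?F p)"
  proof (intro ext)
    fix x y
    show "A x y = (\<Sum>p\<in>?I. ?F p) x y"
    proof (cases "x \<in> X \<and> y \<in> X")
      case False
      then have "?F p x y = 0" for p
        by (auto simp: mat_scale_def adjacency_def johnson_rel_def)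
      then show ?thesis using supp False by (simp add: sum_matrix_apply)
    next
      case True
      let ?e = "equal_nonzero n x y" and ?f = "common_nonzero n x y"
      have le: "?e \<le> w" "?f \<le> w"
      proof -
        have "?e \<le> card (supp n x)" "?f \<le> card (supp n x)"
          unfolding equal_nonzero_def common_nonzero_def
          by (rule card_mono; auto simp: supp_def)+
        then show "?e \<le> w" "?f \<le> w"
          using True by (simp_all add: in_X)
      qed
      have "?F p x y = (if p = (w - ?e, w - ?f) then c ?e ?f else 0)" if "p \<in> ?I" for p
        using le that True by (auto simp: mat_scale_def adjacency_def johnson_rel_def prod_eq_iff)
      then have "(\<Sum>p\<in>?I. ?F p) x y = (\<Sum>p\<in>?I. if p = (w - ?e, w - ?f) then c ?e ?f else 0)"
        by (simp add: sum_matrix_apply)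
      then show ?thesis
        using True by (simp add: c)
    qed
  qed
  moreover have "(\<Sum>p\<in>?I. ?F p) \<in> bose_mesner q n w"
    unfolding bose_mesner_def
    by (intro word_mat.span_sum word_mat.span_scale word_mat.span_base) blast
  ultimately show ?thesis by simp
qed

text \<open>The sum of \<open>\<psi> a u * cnj (\<psi> a v)\<close> over the nontrivial
  \<open>a\<close>, in a form showing that it depends only on which of \<open>u\<close>,
  \<open>v\<close> vanish and whether they agree.\<close>

definition letter_kernel :: "nat \<Rightarrow> nat \<Rightarrow> complex" where
  "letter_kernel u v = (if u = 0 \<or> v = 0 then 0 else if u = v then of_nat (q - 1) - 1 else - 1)"

lemma sum_nontrivial_chars:
  assumes "u < q" "v < q"
  shows "(\<Sum>a\<in>letters - {1}. \<psi> a u * cnj (\<psi> a v)) = letter_kernel u v"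
proof (cases "u = 0 \<or> v = 0")
  case True
  then show ?thesis
    by (auto simp: letter_kernel_def intro!: sum.neutral)
next
  case False
  then have "u \<in> letters" "v \<in> letters"
    using assms by (auto simp: nonzero_letters_def)
  then show ?thesis
    using False by (simp add: letter_kernel_def sum_diff1 char_orthogonal_dual)
qed

text \<open>The possible values of \<open>(supp n a, nontriv a)\<close> for
  \<open>a \<in> W k h\<close>.\<close>

definition support_pairs :: "nat \<Rightarrow> nat \<Rightarrow> (nat set \<times> nat set) set" where
  "support_pairs k h = {(A, B). B \<subseteq> A \<and> A \<subseteq> {1..n} \<and> card A = k \<and> card B = h}"

lemma finite_support_pairs [simp]: "finite (support_pairs k h)"
  by (rule finite_subset[of _ "Pow {1..n} \<times> Pow {1..n}"]) (auto simp: support_pairs_def)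

text \<open>The words of \<open>W k h\<close> are grouped by support \<open>A\<close> and nontrivial
  positions \<open>B\<close>. Within a group the letters at different positions are chosen
  independently, so the sum over words becomes a product of sums over letters.\<close>

lemma C_expand:
  assumes x: "x \<in> X" and y: "y \<in> X"
  shows "C k h x y = (\<Sum>(A, B)\<in>support_pairs k h. \<Prod>i\<in>{1..n}.
    if i \<in> B then letter_kernel (x i) (y i)
    else if i \<in> A then of_bool (x i \<noteq> 0 \<and> y i \<noteq> 0) else 1)"
proof -
  let ?g = "\<lambda>i v. if v = 0 then 1 else \<psi> v (x i) * cnj (\<psi> v (y i))"
  let ?T = "\<lambda>A B i. if i \<in> B then letters - {1} else if i \<in> A then {1} else {0}"
  have lt: "x i < q" "y i < q" if "i \<in> {1..n}" for i
    using that x y by (auto simp: in_X words_def)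
  \<comment> \<open>Each group is a full product set: a letter other than 1 on \<open>B\<close>, the
    letter 1 on the rest of \<open>A\<close>, and 0 elsewhere.\<close>
  have fib: "{a \<in> W k h. (supp n a, nontriv a) = p} = PiE {1..n} (?T (fst p) (snd p))"
    if p: "p \<in> support_pairs k h" for p
  proof (intro equalityI subsetI)
    fix a assume a: "a \<in> {a \<in> W k h. (supp n a, nontriv a) = p}"
    have "a i \<in> ?T (fst p) (snd p) i" if "i \<in> {1..n}" for i
      using that a word_letter[of a i] by (auto simp: in_W supp_def)
    moreover have "a \<in> extensional {1..n}"
      using a by (auto simp: in_W words_def PiE_def)
    ultimately show "a \<in> PiE {1..n} (?T (fst p) (snd p))"
      by (simp add: PiE_def Pi_def)
  next
    fix a assume a: "a \<in> PiE {1..n} (?T (fst p) (snd p))"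
    have sub: "snd p \<subseteq> fst p" "fst p \<subseteq> {1..n}" "card (fst p) = k" "card (snd p) = h"
      using p by (auto simp: support_pairs_def)
    have ai: "a i \<in> ?T (fst p) (snd p) i" if "i \<in> {1..n}" for i
      using a that by (rule PiE_mem)
    have "a i < q" if "i \<in> {1..n}" for i
      using ai[OF that] q2 by (auto simp: nonzero_letters_def split: if_splits)
    then have "a \<in> words q n"
      using a by (auto simp: words_def PiE_def)
    moreover have "i \<in> supp n a \<longleftrightarrow> i \<in> fst p" "i \<in> nontriv a \<longleftrightarrow> i \<in> snd p" for i
      using ai[of i] sub by (auto simp: supp_def nonzero_letters_def split: if_splits)
    then have "supp n a = fst p" "nontriv a = snd p"
      by blast+
    ultimately show "a \<in> {a \<in> W k h. (supp n a, nontriv a) = p}"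
      using sub by (auto simp: in_W prod_eq_iff)
  qed
  have "C k h x y = (\<Sum>a\<in>W k h. \<Prod>i\<in>{1..n}. ?g i (a i))"
    using x y by (auto simp: C_mat_def pairing_eq_prod simp flip: prod.distrib intro!: sum.cong prod.cong)
  also have "\<dots> = (\<Sum>p\<in>support_pairs k h. \<Sum>a\<in>{a \<in> W k h. (supp n a, nontriv a) = p}. \<Prod>i\<in>{1..n}. ?g i (a i))"
  proof (rule sum.group[symmetric])
    show "(\<lambda>a. (supp n a, nontriv a)) ` W k h \<subseteq> support_pairs k h"
      by (auto simp: in_W support_pairs_def supp_def)
  qed simp_all
  also have "\<dots> = (\<Sum>p\<in>support_pairs k h. \<Sum>a\<in>PiE {1..n} (?T (fst p) (snd p)). \<Prod>i\<in>{1..n}. ?g i (a i))"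
    by (simp only: fib cong: sum.cong)
  also have "\<dots> = (\<Sum>p\<in>support_pairs k h. \<Prod>i\<in>{1..n}. \<Sum>v\<in>?T (fst p) (snd p) i. ?g i v)"
    by (intro sum.cong refl prod_sum_PiE[symmetric]) auto
  also have "\<dots> = (\<Sum>p\<in>support_pairs k h. \<Prod>i\<in>{1..n}.
    if i \<in> snd p then letter_kernel (x i) (y i)
    else if i \<in> fst p then of_bool (x i \<noteq> 0 \<and> y i \<noteq> 0) else 1)"
  proof (intro sum.cong prod.cong refl)
    fix p i assume i: "i \<in> {1..n}"
    have "(\<Sum>v\<in>letters - {1}. ?g i v) = (\<Sum>v\<in>letters - {1}. \<psi> v (x i) * cnj (\<psi> v (y i)))"
      by (intro sum.cong refl) auto
    also have "\<dots> = letter_kernel (x i) (y i)"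
      using lt[OF i] by (rule sum_nontrivial_chars)
    finally have 1: "(\<Sum>v\<in>letters - {1}. ?g i v) = letter_kernel (x i) (y i)" .
    have 2: "?g i 1 = of_bool (x i \<noteq> 0 \<and> y i \<noteq> 0)"
      using lt[OF i] char_at_0[OF one_letter] by (auto simp: nonzero_letters_def)
    show "(\<Sum>v\<in>?T (fst p) (snd p) i. ?g i v) = (if i \<in> snd p then letter_kernel (x i) (y i)
      else if i \<in> fst p then of_bool (x i \<noteq> 0 \<and> y i \<noteq> 0) else 1)"
      using 1 2 by simp
  qed
  finally show ?thesis
    by (simp add: case_prod_beta)
qed

lemma bij_support_pairs:
  assumes "p permutes {1..n}"
  shows "bij_betw (map_prod ((`) p) ((`) p)) (support_pairs k h) (support_pairs k h)"
proof -
  have inj: "inj p"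
    using assms by (rule permutes_inj)
  have "inj_on (map_prod ((`) p) ((`) p)) (support_pairs k h)"
    using inj by (auto simp: inj_on_def inj_image_eq_iff)
  moreover have "map_prod ((`) p) ((`) p) ` support_pairs k h \<subseteq> support_pairs k h"
  proof (rule image_subsetI)
    fix AB assume AB: "AB \<in> support_pairs k h"
    then have "p ` fst AB \<subseteq> {1..n}"
      using image_mono[of "fst AB" "{1..n}" p] permutes_image[OF assms]
      by (auto simp only: support_pairs_def case_prod_beta mem_Collect_eq)
    moreover have "p ` snd AB \<subseteq> p ` fst AB"
      using AB by (intro image_mono) (auto simp: support_pairs_def)
    ultimately show "map_prod ((`) p) ((`) p) AB \<in> support_pairs k h"
      using AB card_image[OF inj_on_subset[OF inj]]
      by (cases AB) (simp add: support_pairs_def)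
  qed
  ultimately show ?thesis
    by (metis bij_betw_def endo_inj_surj finite_support_pairs)
qed

text \<open>The factors in \<open>C_expand\<close> see a position only through its class under the
  pair of points. Two pairs in the same relation have equally many positions of each class, so a
  coordinate permutation carries one expansion to the other.\<close>

lemma C_in_bose_mesner: "C k h \<in> bose_mesner q n w"
proof (rule bose_mesnerI)
  fix x y x' y'
  assume X: "x \<in> X" "y \<in> X" "x' \<in> X" "y' \<in> X"
    and e: "equal_nonzero n x y = equal_nonzero n x' y'"
    and f: "common_nonzero n x y = common_nonzero n x' y'"
  \<comment> \<open>Class 0: some letter vanishes; class 1: equal nonzero letters; class 2: distinct
    nonzero letters. With \<open>e\<close> equal and \<open>f\<close> common nonzero positions, the
    classes have sizes \<open>n - f\<close>, \<open>e\<close> and \<open>f - e\<close>.\<close>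
  define cls :: "word \<Rightarrow> word \<Rightarrow> nat \<Rightarrow> nat" where
    "cls x y i = (if x i = 0 \<or> y i = 0 then 0 else if x i = y i then 1 else 2)" for x y i
  have cls1: "card {i \<in> {1..n}. cls x y i = 1} = equal_nonzero n x y" for x y
    unfolding equal_nonzero_def by (rule arg_cong[of _ _ card]) (auto simp: cls_def)
  have cls2: "card {i \<in> {1..n}. cls x y i = 2} + equal_nonzero n x y = common_nonzero n x y" for x y
    unfolding equal_nonzero_def common_nonzero_def
    by (subst card_Un_disjoint[symmetric]) (auto simp: cls_def intro!: arg_cong[of _ _ card])
  have cls0: "card {i \<in> {1..n}. cls x y i = 0} + common_nonzero n x y = n" for x y
  proof -
    have "card {i \<in> {1..n}. cls x y i = 0} + common_nonzero n x y =
      card ({i \<in> {1..n}. cls x y i = 0} \<union> {i \<in> {1..n}. x i \<noteq> 0 \<and> y i \<noteq> 0})"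
      unfolding common_nonzero_def by (subst card_Un_disjoint) (auto simp: cls_def)
    also have "{i \<in> {1..n}. cls x y i = 0} \<union> {i \<in> {1..n}. x i \<noteq> 0 \<and> y i \<noteq> 0} = {1..n}"
      by (auto simp: cls_def)
    finally show ?thesis by simp
  qed
  have "card {i \<in> {1..n}. cls x y i = v} = card {i \<in> {1..n}. cls x' y' i = v}" for v
  proof -
    consider "v = 0" | "v = 1" | "v = 2" | "v > 2" by linarith
    then show ?thesis
    proof cases
      case 1 then show ?thesis using cls0[of x y] cls0[of x' y'] f by simp
    next
      case 2 then show ?thesis using cls1 e by simp
    next
      case 3 then show ?thesis using cls2[of x y] cls2[of x' y'] e f by simp
    next
      case 4
      then have "cls u v' i \<noteq> v" for u v' i by (simp add: cls_def)
      then show ?thesis by simp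
    qed
  qed
  then obtain p where p: "p permutes {1..n}" "\<And>i. i \<in> {1..n} \<Longrightarrow> cls x y i = cls x' y' (p i)"
    using exists_permutation_matching[of "{1..n}" "cls x y" "cls x' y'"] by auto
  let ?F = "\<lambda>x y (A, B) i. if i \<in> B then letter_kernel (x i) (y i)
    else if i \<in> A then of_bool (x i \<noteq> 0 \<and> y i \<noteq> 0) else (1 :: complex)"
  have lk: "letter_kernel (x i) (y i) = (case cls x y i of 0 \<Rightarrow> 0 | Suc 0 \<Rightarrow> of_nat (q - 1) - 1 | _ \<Rightarrow> -1)"
    "(x i \<noteq> 0 \<and> y i \<noteq> 0) = (cls x y i \<noteq> 0)" for x y i
    by (auto simp: cls_def letter_kernel_def numeral_2_eq_2)
  have inj: "inj p"
    using p(1) by (rule permutes_inj)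
  have "C k h x' y' = (\<Sum>AB\<in>support_pairs k h. \<Prod>i\<in>{1..n}. ?F x' y' AB i)"
    using X by (simp add: C_expand case_prod_beta)
  \<comment> \<open>Both the sum over pairs \<open>(A, B)\<close> and the product over positions are
    reindexed by \<open>p\<close>, so that membership in \<open>A\<close> and \<open>B\<close> is
    unchanged.\<close>
  also have "\<dots> = (\<Sum>AB\<in>support_pairs k h. \<Prod>i\<in>{1..n}. ?F x' y' (map_prod ((`) p) ((`) p) AB) i)"
    by (rule sum.reindex_bij_betw[OF bij_support_pairs[OF p(1)], symmetric])
  also have "\<dots> = (\<Sum>AB\<in>support_pairs k h. \<Prod>i\<in>{1..n}. ?F x' y' (map_prod ((`) p) ((`) p) AB) (p i))"
    by (intro sum.cong refl prod.reindex_bij_betw[symmetric] permutes_imp_bij[OF p(1)])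
  also have "\<dots> = (\<Sum>AB\<in>support_pairs k h. \<Prod>i\<in>{1..n}. ?F x y AB i)"
  proof (intro sum.cong prod.cong refl)
    fix AB i assume "i \<in> {1..n}"
    then have "letter_kernel (x' (p i)) (y' (p i)) = letter_kernel (x i) (y i)"
      "(x' (p i) \<noteq> 0 \<and> y' (p i) \<noteq> 0) = (x i \<noteq> 0 \<and> y i \<noteq> 0)"
      using p(2)[of i] by (simp_all only: lk)
    then show "?F x' y' (map_prod ((`) p) ((`) p) AB) (p i) = ?F x y AB i"
      by (simp only: case_prod_beta map_prod_simp fst_map_prod snd_map_prod inj_image_mem_iff[OF inj])
  qed
  also have "\<dots> = C k h x y"
    using X by (simp add: C_expand case_prod_beta)
  finally show "C k h x y = C k h x' y'" by simp
qed (auto simp: C_mat_def)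

section \<open>Fourier coefficients and kernels\<close>

abbreviation L where "L \<equiv> johnson_index n w"
abbreviation \<B> where "\<B> \<equiv> bose_mesner q n w"

definition fourier :: "word \<Rightarrow> (word \<Rightarrow> complex) \<Rightarrow> complex" where
  "fourier a v = (\<Sum>y\<in>X. cnj (pairing a y) * v y)"

lemma mat_vec_C:
  assumes "x \<in> X"
  shows "mat_vec X (C k h) v x = (\<Sum>a\<in>W k h. pairing a x * fourier a v)"
proof -
  have "mat_vec X (C k h) v x = (\<Sum>y\<in>X. \<Sum>a\<in>W k h. pairing a x * (cnj (pairing a y) * v y))"
    using assms by (simp add: mat_vec_def C_mat_def sum_distrib_right mult.assoc)
  also have "\<dots> = (\<Sum>a\<in>W k h. pairing a x * fourier a v)"
    by (subst sum.swap) (simp add: fourier_def sum_distrib_left)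
  finally show ?thesis .
qed

text \<open>\<open>C k h\<close> is a Gram matrix: its quadratic form at \<open>v\<close> is the sum
  of the squared absolute values of \<open>fourier a v\<close>, which vanishes only if every term
  does.\<close>

lemma kernel_C:
  "(\<forall>x\<in>X. mat_vec X (C k h) v x = 0) \<longleftrightarrow> (\<forall>a\<in>W k h. fourier a v = 0)"
proof
  assume *: "\<forall>x\<in>X. mat_vec X (C k h) v x = 0"
  have "of_real (\<Sum>a\<in>W k h. (norm (fourier a v))\<^sup>2) = (\<Sum>a\<in>W k h. (\<Sum>x\<in>X. pairing a x * cnj (v x)) * fourier a v)"
    unfolding of_real_sum complex_norm_square by (simp add: fourier_def mult.commute)
  also have "\<dots> = (\<Sum>a\<in>W k h. \<Sum>x\<in>X. cnj (v x) * (pairing a x * fourier a v))"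
    unfolding sum_distrib_right by (simp only: mult_ac)
  also have "\<dots> = (\<Sum>x\<in>X. cnj (v x) * mat_vec X (C k h) v x)"
    by (subst sum.swap) (simp add: mat_vec_C sum_distrib_left)
  also have "\<dots> = 0"
    using * by simp
  finally have "(\<Sum>a\<in>W k h. (norm (fourier a v))\<^sup>2) = 0"
    by (simp only: of_real_eq_0_iff)
  then show "\<forall>a\<in>W k h. fourier a v = 0"
    by (simp add: sum_nonneg_eq_0_iff)
qed (simp add: mat_vec_C)

text \<open>Putting the letter 1 at a new position \<open>i\<close> multiplies the pairing by the
  indicator of \<open>x i \<noteq> 0\<close>. If the support of \<open>x\<close> contains that of
  \<open>a\<close>, there are \<open>w - k\<close> such positions left; otherwise both sides
  vanish.\<close>

lemma sum_extend_pairing: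
  assumes a: "a \<in> W k h" and x: "x \<in> X"
  shows "(\<Sum>i\<in>{1..n} - supp n a. pairing (a(i := 1)) x) = of_nat (w - k) * pairing a x"
proof -
  have aw: "a \<in> words q n" and ck: "card (supp n a) = k"
    using a by (auto simp: in_W)
  have ext: "pairing (a(i := 1)) x = of_bool (x i \<noteq> 0) * pairing a x" if i: "i \<in> {1..n} - supp n a" for i
  proof -
    have "supp n (a(i := 1)) = insert i (supp n a)" "i \<notin> supp n a"
      using i by (auto simp: supp_def)
    moreover have "\<psi> 1 (x i) = of_bool (x i \<noteq> 0)"
      using word_letter[of x i] char_at_0[OF one_letter] x i by (auto simp: in_X supp_def)
    moreover have "(\<Prod>j\<in>supp n a. \<psi> ((a(i := 1)) j) (x j)) = pairing a x"
      unfolding word_pairing_def using i by (intro prod.cong) auto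
    ultimately show ?thesis
      by (simp add: word_pairing_def)
  qed
  have "(\<Sum>i\<in>{1..n} - supp n a. pairing (a(i := 1)) x) = (\<Sum>i\<in>{1..n} - supp n a. of_bool (x i \<noteq> 0)) * pairing a x"
    by (simp only: ext sum_distrib_right cong: sum.cong)
  also have "(\<Sum>i\<in>{1..n} - supp n a. of_bool (x i \<noteq> 0)) = (of_nat (card (supp n x - supp n a)) :: complex)"
    by (simp add: sum_of_bool_eq) (rule arg_cong[of _ _ card], auto simp: supp_def)
  also have "of_nat (card (supp n x - supp n a)) * pairing a x = of_nat (w - k) * pairing a x"
  proof (cases "supp n a \<subseteq> supp n x")
    case True
    then show ?thesis
      using x ck by (simp add: card_Diff_subset in_X)
  next
    case False
    then show ?thesis
      using pairing_eq_0[OF aw] by simp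
  qed
  finally show ?thesis .
qed

text \<open>Downward induction from \<open>r\<close>: by \<open>sum_extend_pairing\<close>,
  \<open>w - k\<close> times a coefficient at level \<open>k\<close> is a sum of coefficients at
  level \<open>k + 1\<close> with the same \<open>h\<close>, and \<open>w - k > 0\<close> for
  \<open>k < r \<le> w\<close>.\<close>

lemma fourier_descend:
  assumes "\<forall>b\<in>W r h. fourier b v = 0" "r \<le> w" "k \<le> r"
  shows "\<forall>a\<in>W k h. fourier a v = 0"
  using assms(3)
proof (induction rule: inc_induct)
  case base
  then show ?case using assms(1) .
next
  case (step k)
  show ?case
  proof
    fix a assume a: "a \<in> W k h"
    have up: "a(i := 1) \<in> W (Suc k) h" if i: "i \<in> {1..n} - supp n a" for i
    proof -
      have "supp n (a(i := 1)) = insert i (supp n a)" "nontriv (a(i := 1)) = nontriv a" "i \<notin> supp n a"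
        using i by (auto simp: supp_def)
      moreover have "a(i := 1) \<in> words q n"
        using a i q2 by (auto simp: in_W words_def PiE_def Pi_def extensional_def)
      ultimately show ?thesis
        using a by (simp add: in_W)
    qed
    have "of_nat (w - k) * fourier a v = (\<Sum>y\<in>X. cnj (of_nat (w - k) * pairing a y) * v y)"
      by (simp add: fourier_def sum_distrib_left mult_ac)
    also have "\<dots> = (\<Sum>y\<in>X. \<Sum>i\<in>{1..n} - supp n a. cnj (pairing (a(i := 1)) y) * v y)"
      using a by (intro sum.cong refl) (simp flip: sum_extend_pairing add: sum_distrib_right)
    also have "\<dots> = (\<Sum>i\<in>{1..n} - supp n a. fourier (a(i := 1)) v)"
      by (subst sum.swap) (simp add: fourier_def)
    also have "\<dots> = 0"
      using step.IH up by (intro sum.neutral) blast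
    finally show "fourier a v = 0"
      using step.hyps assms(2) by simp
  qed
qed

section \<open>Adjoints and orthogonal components in spans of the \<open>C k h\<close>\<close>

lemma adjoint_C: "adjoint (C k h) = C k h"
  by (auto simp: adjoint_def C_mat_def fun_eq_iff mult.commute)

text \<open>The generators are Hermitian and the span is closed under complex scalars, so
  conjugating the coefficients stays inside it.\<close>

lemma adjoint_span_C:
  assumes "S \<subseteq> {C k h | k h. True}" "A \<in> word_mat.span S"
  shows "adjoint A \<in> word_mat.span S"
proof -
  have "adjoint B = B" if "B \<in> S" for B
    using that assms(1) adjoint_C by auto
  then have "word_mat.span S \<subseteq> {A. adjoint A \<in> word_mat.span S}"
    by (intro word_mat.span_minimal)
      (auto simp: word_mat.subspace_def adjoint_zero adjoint_add adjoint_scale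
        intro: word_mat.span_zero word_mat.span_add word_mat.span_scale word_mat.span_base)
  then show ?thesis using assms(2) by auto
qed

lemma span_C_vanishes:
  assumes "S \<subseteq> {C k h | k h. True}" "A \<in> word_mat.span S" "x \<notin> X"
  shows "A x y = 0"
proof -
  have "word_mat.span S \<subseteq> {A. A x y = 0}"
    using assms(1,3)
    by (intro word_mat.span_minimal) (auto simp: word_mat.subspace_def mat_scale_def C_mat_def)
  then show ?thesis using assms(2) by auto
qed

lemma span_C_subset_bose_mesner:
  assumes "S \<subseteq> {C k h | k h. True}" "A \<in> word_mat.span S"
  shows "A \<in> \<B>"
proof -
  have "S \<subseteq> \<B>"
    using assms(1) C_in_bose_mesner by auto
  then show ?thesis
    using assms(2) word_mat.span_mono[of S \<B>] unfolding bose_mesner_def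
    by (auto simp: word_mat.span_span)
qed

text \<open>The two parts multiply to zero, so \<open>P\<^sup>2 - P = Q - Q\<^sup>2\<close> has vanishing product with its
  adjoint.\<close>

lemma orthogonal_parts_idempotent:
  assumes P: "P \<in> word_mat.span {C k h | k h. (k, h) \<in> K \<and> h = j}"
    and Q: "Q \<in> word_mat.span {C k h | k h. (k, h) \<in> K \<and> h \<noteq> j}"
    and idem: "mat_mult X (P + Q) (P + Q) = P + Q"
  shows "mat_mult X P Q = 0" "mat_mult X Q P = 0" "mat_mult X P P = P" "mat_mult X Q Q = Q"
proof -
  let ?S = "{C k h | k h. (k, h) \<in> K \<and> h = j}" and ?S' = "{C k h | k h. (k, h) \<in> K \<and> h \<noteq> j}"
  have S: "?S \<subseteq> {C k h | k h. True}" "?S' \<subseteq> {C k h | k h. True}"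
    by auto
  have orth: "mat_mult X A B = 0" "mat_mult X B A = 0"
    if "A \<in> word_mat.span ?S" "B \<in> word_mat.span ?S'" for A B
  proof -
    show "mat_mult X A B = 0"
      using that by (rule mat_mult_span_eq_0) (auto intro!: C_mult_C)
    show "mat_mult X B A = 0"
      using that(2,1) by (rule mat_mult_span_eq_0) (auto intro!: C_mult_C)
  qed
  show PQ: "mat_mult X P Q = 0" and QP: "mat_mult X Q P = 0"
    using orth P Q by auto
  define U where "U = mat_mult X P P - P"
  have U': "U = Q - mat_mult X Q Q"
    using idem unfolding U_def by (simp add: mat_mult_add_left mat_mult_add_right PQ QP algebra_simps)
  \<comment> \<open>Written with \<open>Q\<close>, the matrix \<open>U\<close> is killed by
    \<open>adjoint P\<close>; written with \<open>P\<close>, its adjoint ends in the factor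
    \<open>adjoint P\<close>.\<close>
  have PU: "mat_mult X (adjoint P) U = 0"
    unfolding U' using orth(1)[OF adjoint_span_C[OF S(1) P] Q]
    by (simp add: mat_mult_diff_right mat_mult_zero_left flip: mat_mult_assoc)
  have "mat_mult X (adjoint U) U = 0"
    unfolding U_def adjoint_diff adjoint_mult mat_mult_diff_left mat_mult_assoc
    by (simp add: PU[unfolded U_def] mat_mult_zero_right)
  then have "U x y = 0" if "x \<in> X" for x y
    using adjoint_mult_self_eq_0[OF finite_X] that by blast
  \<comment> \<open>Rows outside \<open>X\<close> escape the positivity argument, but there
    \<open>P\<close> itself is zero.\<close>
  moreover have "U x y = 0" if "x \<notin> X" for x y
    using that span_C_vanishes[OF S(1) P that] by (simp add: U_def mat_mult_def)
  ultimately have "U = 0"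
    by (intro ext) (auto simp: zero_fun_def)
  then show "mat_mult X P P = P" "mat_mult X Q Q = Q"
    using U_def U' by simp_all
qed

lemma X_nonempty: "X \<noteq> {}"
proof -
  let ?x = "\<lambda>i. if i \<in> {1..n} then (if i \<le> w then 1 else 0) else undefined"
  have "supp n ?x = {1..w}"
    using wn by (auto simp: supp_def)
  then have "?x \<in> X"
    using q2 by (auto simp: in_X words_def)
  then show ?thesis by blast
qed

section \<open>Coordinate permutations and the all-ones vector\<close>

lemma permute_words: "p permutes {1..n} \<Longrightarrow> x \<in> words q n \<Longrightarrow> x \<circ> p \<in> words q n"
  using permutes_in_image[of p "{1..n}"] permutes_not_in[of p "{1..n}"]
  by (auto simp: words_def PiE_def Pi_def extensional_def)

lemma card_permute_preimage:
  assumes "p permutes {1..n}"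
  shows "card {i \<in> {1..n}. Q (p i)} = card {i \<in> {1..n}. Q i}"
proof (rule bij_betw_same_card)
  show "bij_betw p {i \<in> {1..n}. Q (p i)} {i \<in> {1..n}. Q i}"
    using permutes_inj_on[OF assms] permutes_image[OF assms] permutes_in_image[OF assms]
    by (auto simp: bij_betw_def image_iff simp del: atLeastAtMost_iff)
qed

lemma bij_permute:
  assumes p: "p permutes {1..n}" and S: "S \<subseteq> words q n" "finite S"
    and closed: "\<And>x. x \<in> S \<Longrightarrow> x \<circ> p \<in> S"
  shows "bij_betw (\<lambda>x. x \<circ> p) S S"
proof -
  have "inj_on (\<lambda>x. x \<circ> p) S"
  proof (rule inj_onI)
    fix x y assume "x \<circ> p = y \<circ> p"
    then have "x \<circ> p \<circ> Hilbert_Choice.inv p = y \<circ> p \<circ> Hilbert_Choice.inv p"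
      by simp
    then show "x = y"
      by (simp add: o_assoc[symmetric] permutes_inv_o(1)[OF p])
  qed
  moreover have "(\<lambda>x. x \<circ> p) ` S \<subseteq> S"
    using closed by auto
  ultimately show ?thesis
    using endo_inj_surj[OF S(2)] by (simp add: bij_betw_def)
qed

lemma card_supp_permute: "p permutes {1..n} \<Longrightarrow> card (supp n (x \<circ> p)) = card (supp n x)"
  using card_permute_preimage[of p "\<lambda>i. x i \<noteq> 0"] by (simp add: supp_def)

lemma bij_permute_X:
  assumes "p permutes {1..n}"
  shows "bij_betw (\<lambda>x. x \<circ> p) X X"
  using assms by (rule bij_permute) (auto simp: in_X permute_words[OF assms] card_supp_permute[OF assms])

lemma bij_permute_W:
  assumes "p permutes {1..n}"
  shows "bij_betw (\<lambda>x. x \<circ> p) (W k h) (W k h)"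
proof (rule bij_permute[OF assms])
  fix a assume "a \<in> W k h"
  moreover have "card (nontriv (a \<circ> p)) = card (nontriv a)"
    using card_permute_preimage[OF assms, of "\<lambda>i. a i \<noteq> 0 \<and> a i \<noteq> 1"] by (simp only: o_apply)
  ultimately show "a \<circ> p \<in> W k h"
    by (simp only: in_W permute_words[OF assms] card_supp_permute[OF assms] simp_thms)
qed (auto simp: in_W)

lemma exists_permutation_supp:
  assumes "card (supp n x) = card (supp n y)"
  obtains p where "p permutes {1..n}" "supp n (x \<circ> p) = supp n y"
proof -
  have "card {i \<in> {1..n}. (y i \<noteq> 0) = v} = card {i \<in> {1..n}. (x i \<noteq> 0) = v}" for v
  proof (cases v)
    case True
    then show ?thesis using assms by (simp add: supp_def)
  next
    case False
    have "card {i \<in> {1..n}. z i = 0} = n - card (supp n z)" for z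
    proof -
      have "{i \<in> {1..n}. z i = 0} = {1..n} - supp n z"
        by (auto simp: supp_def)
      moreover have "supp n z \<subseteq> {1..n}"
        by (auto simp: supp_def)
      ultimately show ?thesis
        by (simp only: card_Diff_subset[OF finite_supp] card_atLeastAtMost diff_Suc_1)
    qed
    then show ?thesis using False assms by simp
  qed
  then obtain p where p: "p permutes {1..n}" "\<And>i. i \<in> {1..n} \<Longrightarrow> (y i \<noteq> 0) = (x (p i) \<noteq> 0)"
    using exists_permutation_matching[of "{1..n}" "\<lambda>i. y i \<noteq> 0" "\<lambda>i. x i \<noteq> 0"] by auto
  then have "supp n (x \<circ> p) = supp n y"
    by (auto simp: supp_def)
  then show ?thesis
    using that p by blast
qed

text \<open>All letters of \<open>a\<close> on its support are 1, so every factor is 1 unless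
  \<open>x\<close> vanishes at that position. The letters of \<open>x\<close> do not matter, only
  its support.\<close>

lemma pairing_trivial:
  assumes "a \<in> W k 0" "x \<in> X"
  shows "pairing a x = of_bool (supp n a \<subseteq> supp n x)"
proof (cases "supp n a \<subseteq> supp n x")
  case True
  have "nontriv a = {}"
    using assms(1) by (simp add: in_W)
  then have "a i = 1" if "i \<in> supp n a" for i
    using that by (auto simp: supp_def)
  moreover have "x i \<in> letters" if "i \<in> supp n a" for i
    using that True assms(2) word_letter[of x i] by (auto simp: in_X)
  ultimately show ?thesis
    using True by (simp add: word_pairing_def)
next
  case False
  then show ?thesis
    using assms pairing_eq_0 by (simp add: in_W)
qed

text \<open>A coordinate permutation preserves \<open>X\<close> and moves the support of
  \<open>a\<close> onto that of \<open>b\<close>; by \<open>pairing_trivial\<close> the support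
  determines the pairing.\<close>

lemma fourier_trivial_one:
  assumes "a \<in> W k 0" "b \<in> W k 0"
  shows "fourier a (\<lambda>_. 1) = fourier b (\<lambda>_. 1)"
proof -
  obtain p where p: "p permutes {1..n}" "supp n (a \<circ> p) = supp n b"
    using exists_permutation_supp[of a b] assms by (auto simp: in_W)
  have ap: "a \<circ> p \<in> W k 0"
    using bij_permute_W[OF p(1)] assms(1) by (auto simp: bij_betw_def)
  have "fourier a (\<lambda>_. 1) = (\<Sum>y\<in>X. cnj (pairing (a \<circ> p) (y \<circ> p)))"
    by (simp add: fourier_def pairing_permute[OF p(1)])
  also have "\<dots> = (\<Sum>y\<in>X. cnj (pairing (a \<circ> p) y))"
    by (rule sum.reindex_bij_betw[OF bij_permute_X[OF p(1)]])
  also have "\<dots> = fourier b (\<lambda>_. 1)"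
    using pairing_trivial[OF ap] pairing_trivial[OF assms(2)] p(2) by (simp add: fourier_def)
  finally show ?thesis .
qed

text \<open>The coefficient counts the points whose support contains that of \<open>a\<close>, and
  \<open>k \<le> w \<le> n\<close> provides one.\<close>

lemma fourier_trivial_one_nonzero:
  assumes "a \<in> W k 0" "k \<le> w"
  shows "fourier a (\<lambda>_. 1) \<noteq> 0"
proof -
  have "fourier a (\<lambda>_. 1) = (\<Sum>y\<in>X. of_bool (supp n a \<subseteq> supp n y))"
    unfolding fourier_def by (intro sum.cong refl) (simp add: pairing_trivial[OF assms(1)] del: of_bool_eq_iff)
  also have "\<dots> = of_nat (card {y \<in> X. supp n a \<subseteq> supp n y})"
    by (simp add: sum_of_bool_eq) (rule arg_cong[of _ _ card], auto)
  finally have "fourier a (\<lambda>_. 1) = of_nat (card {y \<in> X. supp n a \<subseteq> supp n y})" .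
  moreover have "\<exists>y\<in>X. supp n a \<subseteq> supp n y"
  proof -
    have "supp n a \<subseteq> {1..n}"
      by (auto simp: supp_def)
    moreover have "card (supp n a) = k"
      using assms(1) by (simp only: in_W)
    ultimately have "\<exists>S. supp n a \<subseteq> S \<and> S \<subseteq> {1..n} \<and> card S = w"
      using assms(2) wn by (intro exists_subset_between) simp_all
    then obtain S where S: "supp n a \<subseteq> S" "S \<subseteq> {1..n}" "card S = w"
      by blast
    let ?y = "\<lambda>i. if i \<in> {1..n} then (if i \<in> S then 1 else 0) else undefined"
    have "supp n ?y = S"
      using S(2) by (auto simp: supp_def)
    then have "?y \<in> X" "supp n a \<subseteq> supp n ?y"
      using q2 S by (auto simp: in_X words_def)
    then show ?thesis by blast
  qed
  then have "card {y \<in> X. supp n a \<subseteq> supp n y} \<noteq> 0"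
    by auto
  ultimately show ?thesis
    by (metis of_nat_eq_0_iff)
qed

text \<open>The row sum is invariant under coordinate permutations, which act transitively on
  supports of size \<open>w\<close>. What remains is a change of letters on a fixed support,
  invisible to the pairings with \<open>W k 0\<close>.\<close>

lemma C_row_sum:
  assumes "x \<in> X" "x' \<in> X"
  shows "mat_vec X (C k 0) (\<lambda>_. 1) x = mat_vec X (C k 0) (\<lambda>_. 1) x'"
proof -
  have eq: "mat_vec X (C k 0) (\<lambda>_. 1) (x \<circ> p) = mat_vec X (C k 0) (\<lambda>_. 1) x"
    if p: "p permutes {1..n}" and x: "x \<in> X" for p x
  proof -
    have xp: "x \<circ> p \<in> X"
      using bij_permute_X[OF p] x by (auto simp: bij_betw_def)
    have "mat_vec X (C k 0) (\<lambda>_. 1) x = (\<Sum>a\<in>W k 0. pairing (a \<circ> p) (x \<circ> p) * fourier (a \<circ> p) (\<lambda>_. 1))"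
      unfolding mat_vec_C[OF x]
    proof (intro sum.cong refl)
      fix a assume a: "a \<in> W k 0"
      then have "a \<circ> p \<in> W k 0"
        using bij_permute_W[OF p] by (auto simp: bij_betw_def)
      then show "pairing a x * fourier a (\<lambda>_. 1) = pairing (a \<circ> p) (x \<circ> p) * fourier (a \<circ> p) (\<lambda>_. 1)"
        using a fourier_trivial_one pairing_permute[OF p] by metis
    qed
    also have "\<dots> = (\<Sum>a\<in>W k 0. pairing a (x \<circ> p) * fourier a (\<lambda>_. 1))"
      by (rule sum.reindex_bij_betw[OF bij_permute_W[OF p]])
    finally show ?thesis
      using mat_vec_C[OF xp] by simp
  qed
  obtain p where p: "p permutes {1..n}" "supp n (x \<circ> p) = supp n x'"
    using exists_permutation_supp[of x x'] assms by (auto simp: in_X)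
  have xp: "x \<circ> p \<in> X"
    using bij_permute_X[OF p(1)] assms by (auto simp: bij_betw_def)
  have "mat_vec X (C k 0) (\<lambda>_. 1) (x \<circ> p) = mat_vec X (C k 0) (\<lambda>_. 1) x'"
    using assms xp p(2) by (simp add: mat_vec_C pairing_trivial)
  then show ?thesis
    using eq[OF p(1) assms(1)] by simp
qed

lemma C_0_0: "x \<in> X \<Longrightarrow> y \<in> X \<Longrightarrow> C 0 0 x y = of_nat (card (W 0 0))"
  by (simp add: C_mat_def in_W word_pairing_def)

text \<open>Both properties hold for the 0/1-valued pairings behind \<open>C k 0\<close> and are
  linear. They make \<open>E i 0\<close> act as a scalar on the all-ones matrix from either
  side.\<close>

lemma trivial_span_symmetric_row_sum:
  assumes "A \<in> word_mat.span {C k 0 | k. True}"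
  shows "A x y = A y x" "\<exists>\<rho>. \<forall>x\<in>X. mat_vec X A (\<lambda>_. 1) x = \<rho>"
proof -
  have "pairing a x * cnj (pairing a y) = pairing a y * cnj (pairing a x)"
    if "a \<in> W k 0" "x \<in> X" "y \<in> X" for a k
    unfolding pairing_trivial[OF that(1,2)] pairing_trivial[OF that(1,3)] of_bool_def by simp
  then have "C k 0 x y = C k 0 y x" for k
    by (simp add: C_mat_def cong: sum.cong)
  then have "word_mat.span {C k 0 | k. True} \<subseteq> {A. A x y = A y x}"
    by (intro word_mat.span_minimal) (auto simp: word_mat.subspace_def mat_scale_def)
  then show "A x y = A y x"
    using assms by blast
  have "\<exists>\<rho>. \<forall>x\<in>X. mat_vec X (C k 0) (\<lambda>_. 1) x = \<rho>" for k
    using C_row_sum X_nonempty by blast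
  then have "word_mat.span {C k 0 | k. True} \<subseteq> {A. \<exists>\<rho>. \<forall>x\<in>X. mat_vec X A (\<lambda>_. 1) x = \<rho>}"
    by (intro word_mat.span_minimal) (auto simp: word_mat.subspace_def mat_vec_add mat_vec_scale mat_vec_zero)
  then show "\<exists>\<rho>. \<forall>x\<in>X. mat_vec X A (\<lambda>_. 1) x = \<rho>"
    using assms by blast
qed

lemma fourier_diff_scale: "fourier a (\<lambda>y. v y - c * u y) = fourier a v - c * fourier a u"
  by (simp add: fourier_def algebra_simps sum_subtractf sum_distrib_left)

end

section \<open>Primitive idempotents\<close>

locale nonbinary_johnson_idempotents = nonbinary_johnson +
  fixes E :: "nat \<Rightarrow> nat \<Rightarrow> word_mat"
  assumes indexed: "indexed_idempotents q n w \<psi> E"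
begin

lemma E_primitive: "(i, j) \<in> L \<Longrightarrow> primitive_idempotent X \<B> (E i j)"
  and E_in_filtration: "(i, j) \<in> L \<Longrightarrow> E i j \<in> B_filtration q n w \<psi> i j"
  and E_notin_filtration: "(i, j) \<in> L \<Longrightarrow> (k, h) \<in> L \<Longrightarrow> lex_less (k, h) (i, j) \<Longrightarrow>
      E i j \<notin> B_filtration q n w \<psi> k h"
  using indexed unfolding indexed_idempotents_def by fast+

lemma E_props:
  assumes "(i, j) \<in> L"
  shows "E i j \<in> \<B>" "E i j \<noteq> 0" "mat_mult X (E i j) (E i j) = E i j"
  using E_primitive[OF assms] by (auto simp: primitive_idempotent_def)

lemma E_indecomposable:
  assumes "(i, j) \<in> L" "E i j = P + Q" "P \<in> \<B>" "Q \<in> \<B>" "mat_mult X P P = P" "mat_mult X Q Q = Q"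
    "mat_mult X P Q = 0" "mat_mult X Q P = 0"
  shows "P = 0 \<or> Q = 0"
  using E_primitive[OF assms(1)] assms unfolding primitive_idempotent_def by blast

text \<open>\<open>K\<close> is finite, and nonempty because \<open>A \<noteq> 0\<close>, so its
  lexicographic maximum names one filtration step containing \<open>A\<close>. Thus an idempotent
  that is new at \<open>(i, j)\<close> lies in no span of \<open>C k h\<close> with smaller
  indices.\<close>

lemma lex_lower_span_in_filtration:
  assumes A: "A \<in> word_mat.span {C k h | k h. (k, h) \<in> K}" "A \<noteq> 0"
    and K: "K \<subseteq> L" "\<And>p. p \<in> K \<Longrightarrow> lex_less p (i, j)"
  obtains k h where "(k, h) \<in> L" "lex_less (k, h) (i, j)" "A \<in> B_filtration q n w \<psi> k h"
proof -
  have "K \<noteq> {}"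
    using A by auto
  have "finite K"
    using K(1) by (rule finite_subset) (rule finite_subset[of _ "{..w} \<times> {..w}"], auto simp: johnson_index_def)
  then have "\<exists>m\<in>K. \<forall>p\<in>K. lex_less p m \<or> p = m"
    using \<open>K \<noteq> {}\<close>
  proof (induction rule: finite_ne_induct)
    case (insert p K)
    then obtain m where m: "m \<in> K" "\<forall>p\<in>K. lex_less p m \<or> p = m" by blast
    show ?case
    proof (cases "lex_less p m")
      case True
      then show ?thesis using m by blast
    next
      case False
      then have "\<forall>p'\<in>insert p K. lex_less p' p \<or> p' = p"
        using m(2) by (fastforce simp: lex_less_def prod_eq_iff)
      then show ?thesis by blast
    qed
  qed auto
  then obtain k h where m: "(k, h) \<in> K" "\<forall>p\<in>K. lex_less p (k, h) \<or> p = (k, h)"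
    by (metis surj_pair)
  have "A \<in> B_filtration q n w \<psi> k h"
  proof -
    have "{C k h | k h. (k, h) \<in> K} \<subseteq>
        {C k' h' | k' h'. (k', h') \<in> L \<and> (lex_less (k', h') (k, h) \<or> (k', h') = (k, h))}"
      using m(2) K(1) by blast
    then show ?thesis
      using A(1) word_mat.span_mono unfolding B_filtration_def by blast
  qed
  then show ?thesis
    using that m K by blast
qed

text \<open>The components of an idempotent belonging to different second indices are orthogonal
  idempotents, so a primitive one has a single second index.\<close>

lemma E_triangular:
  assumes ij: "(i, j) \<in> L"
  obtains \<alpha> P where "\<alpha> \<noteq> 0" "P \<in> word_mat.span {C k j | k. j \<le> k \<and> k < i}"
    "E i j = mat_scale \<alpha> (C i j) + P"
proof -
  let ?K = "{p \<in> L. lex_less p (i, j) \<or> p = (i, j)}"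
  let ?S = "{C k h | k h. (k, h) \<in> ?K \<and> h = j}" and ?S' = "{C k h | k h. (k, h) \<in> ?K \<and> h \<noteq> j}"
  have "{C k h | k h. (k, h) \<in> L \<and> (lex_less (k, h) (i, j) \<or> (k, h) = (i, j))} = ?S \<union> ?S'"
    by blast
  then have "E i j \<in> word_mat.span (?S \<union> ?S')"
    using E_in_filtration[OF ij] unfolding B_filtration_def by simp
  then obtain P Q where P: "P \<in> word_mat.span ?S" and Q: "Q \<in> word_mat.span ?S'" and E: "E i j = P + Q"
    unfolding word_mat.span_Un by blast
  note PQ = orthogonal_parts_idempotent[OF P Q E_props(3)[OF ij, unfolded E]]
  have sub: "?S \<subseteq> {C k h | k h. True}" "?S' \<subseteq> {C k h | k h. True}"
    by blast+
  have notin: "E i j \<notin> word_mat.span {C k h | k h. (k, h) \<in> K}"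
    if "K \<subseteq> L" "\<And>p. p \<in> K \<Longrightarrow> lex_less p (i, j)" for K
    using lex_lower_span_in_filtration[OF _ E_props(2)[OF ij] that] E_notin_filtration[OF ij] by metis
  have "P = 0 \<or> Q = 0"
    using E_indecomposable[OF ij E span_C_subset_bose_mesner[OF sub(1) P] span_C_subset_bose_mesner[OF sub(2) Q]] PQ
    by blast
  \<comment> \<open>Otherwise \<open>E i j\<close> is a combination of \<open>C k h\<close> with
    \<open>h \<noteq> j\<close>, all of smaller index, which \<open>notin\<close> excludes.\<close>
  moreover have "P \<noteq> 0"
  proof
    assume "P = 0"
    then have "E i j \<in> word_mat.span ?S'"
      using E Q by simp
    moreover have "?S' = {C k h | k h. (k, h) \<in> {p \<in> ?K. snd p \<noteq> j}}"
      by auto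
    moreover have "E i j \<notin> word_mat.span {C k h | k h. (k, h) \<in> {p \<in> ?K. snd p \<noteq> j}}"
      by (rule notin) auto
    ultimately show False
      by metis
  qed
  ultimately have EP: "E i j \<in> word_mat.span ?S"
    using E P by simp
  let ?Low = "{C k j | k. j \<le> k \<and> k < i}"
  \<comment> \<open>For \<open>k < i\<close> the bound on \<open>k - j\<close> in
    \<open>johnson_index\<close> follows from that on \<open>i - j\<close>, so only
    \<open>j \<le> k\<close> remains.\<close>
  have "(k, h) \<in> ?K \<and> h = j \<longleftrightarrow> h = j \<and> (k = i \<or> j \<le> k \<and> k < i)" for k h
    using ij by (auto simp: johnson_index_def lex_less_def)
  then have "?S = insert (C i j) ?Low"
    by (simp only:) blast
  then have "E i j \<in> word_mat.span (insert (C i j) ?Low)"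
    using EP by (simp only:)
  then obtain \<alpha> where \<alpha>: "E i j - mat_scale \<alpha> (C i j) \<in> word_mat.span ?Low"
    unfolding word_mat.span_breakdown_eq by blast
  \<comment> \<open>Without the term \<open>C i j\<close>, \<open>E i j\<close> would again lie in a
    span of smaller indices.\<close>
  have "\<alpha> \<noteq> 0"
  proof
    assume "\<alpha> = 0"
    then have "E i j \<in> word_mat.span ?Low"
      using \<alpha> by simp
    moreover have "?Low = {C k h | k h. (k, h) \<in> {(k, h). h = j \<and> j \<le> k \<and> k < i}}"
      by auto
    moreover have "E i j \<notin> word_mat.span {C k h | k h. (k, h) \<in> {(k, h). h = j \<and> j \<le> k \<and> k < i}}"
      by (rule notin) (use ij in \<open>auto simp: johnson_index_def lex_less_def\<close>)
    ultimately show False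
      by metis
  qed
  moreover have "E i j = mat_scale \<alpha> (C i j) + (E i j - mat_scale \<alpha> (C i j))"
    by simp
  ultimately show ?thesis
    using that \<alpha> by blast
qed

section \<open>Kernels of the idempotents and the design condition\<close>

text \<open>For fixed \<open>j\<close>, \<open>E_triangular\<close> is a triangular system in
  \<open>i\<close> with nonzero diagonal. Passing from \<open>E\<close> to \<open>C\<close> is
  forward substitution, by induction on \<open>i\<close>.\<close>

lemma kernel_E_eq_kernel_C:
  assumes L: "\<And>i. j \<le> i \<Longrightarrow> i \<le> r \<Longrightarrow> (i, j) \<in> L"
  shows "(\<forall>i. j \<le> i \<and> i \<le> r \<longrightarrow> (\<forall>x\<in>X. mat_vec X (E i j) v x = 0)) \<longleftrightarrow>
    (\<forall>i. j \<le> i \<and> i \<le> r \<longrightarrow> (\<forall>x\<in>X. mat_vec X (C i j) v x = 0))" (is "?E \<longleftrightarrow> ?C")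
proof
  assume C: ?C
  show ?E
  proof (intro allI impI ballI)
    fix i x assume i: "j \<le> i \<and> i \<le> r" and x: "x \<in> X"
    have "(i, j) \<in> L"
      using L i by blast
    then obtain \<alpha> P where "\<alpha> \<noteq> 0" and P: "P \<in> word_mat.span {C k j | k. j \<le> k \<and> k < i}"
        "E i j = mat_scale \<alpha> (C i j) + P"
      by (rule E_triangular)
    have "mat_vec X P v x = 0"
      using P(1) by (rule mat_vec_span_eq_0) (use C i x in auto)
    then show "mat_vec X (E i j) v x = 0"
      using C i x by (simp add: P(2) mat_vec_add mat_vec_scale)
  qed
next
  assume E: ?E
  have "j \<le> i \<Longrightarrow> i \<le> r \<Longrightarrow> \<forall>x\<in>X. mat_vec X (C i j) v x = 0" for i
  proof (induction i rule: less_induct)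
    case (less i)
    show ?case
    proof
      fix x assume x: "x \<in> X"
      obtain \<alpha> P where P: "\<alpha> \<noteq> 0" "P \<in> word_mat.span {C k j | k. j \<le> k \<and> k < i}"
          "E i j = mat_scale \<alpha> (C i j) + P"
        by (rule E_triangular[OF L[OF less.prems]])
      have "mat_vec X P v x = 0"
        using P(2) by (rule mat_vec_span_eq_0) (use less x in auto)
      moreover have "mat_vec X (E i j) v x = 0"
        using E less.prems x by blast
      ultimately show "mat_vec X (C i j) v x = 0"
        using P(1) by (simp add: P(3) mat_vec_add mat_vec_scale)
    qed
  qed
  then show ?C by blast
qed

text \<open>The bound on \<open>r\<close> puts the whole column \<open>j \<le> i \<le> r\<close>
  into \<open>L\<close>, and by \<open>fourier_descend\<close> the conditions at level
  \<open>r\<close> imply those below.\<close>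

lemma kernel_E:
  assumes "j \<le> r" "r \<le> min w (n - w)"
  shows "(\<forall>i. j \<le> i \<and> i \<le> r \<longrightarrow> (\<forall>x\<in>X. mat_vec X (E i j) v x = 0)) \<longleftrightarrow>
    (\<forall>a\<in>W r j. fourier a v = 0)"
proof -
  have L: "(i, j) \<in> L" if "j \<le> i" "i \<le> r" for i
    using that assms by (auto simp: johnson_index_def)
  have "(\<forall>i. j \<le> i \<and> i \<le> r \<longrightarrow> (\<forall>a\<in>W i j. fourier a v = 0)) \<longleftrightarrow> (\<forall>a\<in>W r j. fourier a v = 0)"
    using fourier_descend[of r j v] assms by auto
  then show ?thesis
    using kernel_E_eq_kernel_C[of j r v] L by (simp add: kernel_C)
qed

text \<open>At the bottom index there are no lower terms, so \<open>E 0 0\<close> is a multiple of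
  \<open>C 0 0\<close>, which is constant on \<open>X \<times> X\<close>.\<close>

lemma E_0_0:
  obtains \<beta> where "E 0 0 = (\<lambda>x y. if x \<in> X \<and> y \<in> X then \<beta> else 0)"
proof -
  have L: "(0, 0) \<in> L"
    by (simp add: johnson_index_def)
  obtain \<alpha> P where "\<alpha> \<noteq> 0" "P \<in> word_mat.span {C k 0 | k. 0 \<le> k \<and> k < 0}"
      "E 0 0 = mat_scale \<alpha> (C 0 0) + P"
    by (rule E_triangular[OF L])
  then have "E 0 0 = mat_scale \<alpha> (C 0 0)"
    by simp
  then have "E 0 0 = (\<lambda>x y. if x \<in> X \<and> y \<in> X then \<alpha> * of_nat (card (W 0 0)) else 0)"
    by (intro ext) (auto simp: mat_scale_def C_0_0, auto simp: C_mat_def)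
  then show ?thesis
    by (rule that)
qed

text \<open>The constant row sum \<open>\<rho>\<close> of \<open>E i 0\<close> satisfies \<open>\<rho>\<^sup>2 = \<rho>\<close>; if \<open>\<rho> = 1\<close>, then \<open>E 0 0\<close>
  splits off \<open>E i 0\<close>.\<close>

lemma E_trivial_row_sum:
  assumes L: "(i, 0) \<in> L" and i: "i > 0" and x: "x \<in> X"
  shows "mat_vec X (E i 0) (\<lambda>_. 1) x = 0"
proof -
  have L0: "(0, 0) \<in> L"
    by (simp add: johnson_index_def)
  obtain \<alpha> P where "\<alpha> \<noteq> 0" and P: "P \<in> word_mat.span {C k 0 | k. 0 \<le> k \<and> k < i}"
      "E i 0 = mat_scale \<alpha> (C i 0) + P"
    by (rule E_triangular[OF L])
  have "P \<in> word_mat.span {C k 0 | k. True}"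
    using P(1) word_mat.span_mono[of "{C k 0 | k. 0 \<le> k \<and> k < i}" "{C k 0 | k. True}"] by blast
  then have A: "E i 0 \<in> word_mat.span {C k 0 | k. True}"
    unfolding P(2) by (rule word_mat.span_add[OF word_mat.span_scale[OF word_mat.span_base], rotated]) auto
  note sym = trivial_span_symmetric_row_sum(1)[OF A]
  obtain \<rho> where \<rho>: "\<And>x. x \<in> X \<Longrightarrow> mat_vec X (E i 0) (\<lambda>_. 1) x = \<rho>"
    using trivial_span_symmetric_row_sum(2)[OF A] by blast
  obtain \<beta> where \<beta>: "E 0 0 = (\<lambda>x y. if x \<in> X \<and> y \<in> X then \<beta> else 0)"
    by (rule E_0_0)
  have sum: "(\<Sum>z\<in>X. E i 0 x z) = (if x \<in> X then \<rho> else 0)" for x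
  proof (cases "x \<in> X")
    case True
    then show ?thesis using \<rho>[OF True] by (simp add: mat_vec_def)
  next
    case False
    then have "E i 0 x z = 0" for z
      using span_C_vanishes[OF _ A] by auto
    then show ?thesis using False by simp
  qed
  \<comment> \<open>As \<open>E 0 0\<close> is a multiple of the all-ones matrix, this product sees
    only row sums of \<open>E i 0\<close>; the reversed product sees column sums, equal to them by
    symmetry.\<close>
  have left: "mat_mult X (E i 0) (E 0 0) = mat_scale \<rho> (E 0 0)"
  proof (intro ext)
    fix x y
    have "mat_mult X (E i 0) (E 0 0) x y = (\<Sum>z\<in>X. E i 0 x z) * (if y \<in> X then \<beta> else 0)"
      by (simp add: mat_mult_def \<beta> sum_distrib_right)
    then show "mat_mult X (E i 0) (E 0 0) x y = mat_scale \<rho> (E 0 0) x y"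
      by (simp add: sum mat_scale_def \<beta>)
  qed
  have right: "mat_mult X (E 0 0) (E i 0) = mat_scale \<rho> (E 0 0)"
  proof (intro ext)
    fix x y
    have "mat_mult X (E 0 0) (E i 0) x y = mat_mult X (E i 0) (E 0 0) y x"
      unfolding mat_mult_def by (intro sum.cong refl) (simp add: \<beta> sym[of _ y] mult.commute)
    also have "\<dots> = mat_scale \<rho> (E 0 0) y x"
      by (simp only: left)
    also have "\<dots> = mat_scale \<rho> (E 0 0) x y"
      by (simp add: mat_scale_def \<beta>)
    finally show "mat_mult X (E 0 0) (E i 0) x y = mat_scale \<rho> (E 0 0) x y" .
  qed
  have "mat_mult X (E i 0) (mat_mult X (E i 0) (E 0 0)) = mat_mult X (E i 0) (E 0 0)"
    using E_props(3)[OF L] by (simp flip: mat_mult_assoc)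
  then have "mat_scale (\<rho> * \<rho>) (E 0 0) = mat_scale \<rho> (E 0 0)"
    by (simp add: left mat_mult_scale_right)
  then have "\<rho> * \<rho> = \<rho>"
    using E_props(2)[OF L0] word_mat.scale_right_imp_eq by blast
  moreover have "\<rho> \<noteq> 1"
  proof
    assume "\<rho> = 1"
    then have abs: "mat_mult X (E i 0) (E 0 0) = E 0 0" "mat_mult X (E 0 0) (E i 0) = E 0 0"
      using left right by simp_all
    have "E i 0 - E 0 0 \<in> \<B>"
      using E_props(1)[OF L] E_props(1)[OF L0] unfolding bose_mesner_def by (rule word_mat.span_diff)
    moreover have "E i 0 = E 0 0 + (E i 0 - E 0 0)"
      by simp
    ultimately have "E 0 0 = 0 \<or> E i 0 - E 0 0 = 0"
      using abs E_props[OF L] E_props[OF L0]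
      by (intro E_indecomposable[OF L]) (auto simp: mat_mult_diff_left mat_mult_diff_right)
    \<comment> \<open>This places \<open>E i 0\<close> in the filtration step of
      \<open>(0, 0)\<close>, which is impossible for \<open>i > 0\<close>.\<close>
    then have "E i 0 = E 0 0"
      using E_props(2)[OF L0] by simp
    then show False
      using E_notin_filtration[OF L L0] E_in_filtration[OF L0] i by (simp add: lex_less_def)
  qed
  ultimately show ?thesis
    using \<rho>[OF x] by (metis mult_cancel_left2)
qed

text \<open>Every \<open>E i 0\<close> with \<open>i > 0\<close> kills the all-ones vector, so a
  multiple of it may be subtracted from \<open>v\<close>. A suitable multiple removes the missing
  index 0, or the common value of the coefficients, and then \<open>kernel_E\<close>
  applies.\<close>

lemma kernel_E_trivial:
  assumes r: "r \<le> min w (n - w)"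
  shows "(\<forall>i. 0 < i \<and> i \<le> r \<longrightarrow> (\<forall>x\<in>X. mat_vec X (E i 0) v x = 0)) \<longleftrightarrow>
    (\<exists>c. \<forall>a\<in>W r 0. fourier a v = c)" (is "?E \<longleftrightarrow> ?F")
proof
  assume E: ?E
  obtain \<beta> where \<beta>: "E 0 0 = (\<lambda>x y. if x \<in> X \<and> y \<in> X then \<beta> else 0)"
    by (rule E_0_0)
  \<comment> \<open>The mean of \<open>v\<close>: the difference has sum zero and is killed by
    \<open>E 0 0\<close>. The factor \<open>* 1\<close> below exhibits the all-ones vector to the
    linearity lemmas.\<close>
  define c where "c = (\<Sum>y\<in>X. v y) / of_nat (card X)"
  let ?u = "\<lambda>y. v y - c * 1"
  have "mat_vec X (E i 0) ?u x = 0" if "i \<le> r" "x \<in> X" for i x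
  proof (cases "i = 0")
    case True
    have "mat_vec X (E 0 0) ?u x = \<beta> * (\<Sum>y\<in>X. v y - c)"
      using that by (simp add: mat_vec_def \<beta> sum_distrib_left)
    also have "(\<Sum>y\<in>X. v y - c) = 0"
      using X_nonempty by (simp add: sum_subtractf c_def)
    finally show ?thesis using True by simp
  next
    case False
    have "(i, 0) \<in> L"
      using that r by (auto simp: johnson_index_def)
    then show ?thesis
      using E False that E_trivial_row_sum by (simp only: mat_vec_vec_diff_scale) simp
  qed
  then have "\<forall>a\<in>W r 0. fourier a ?u = 0"
    unfolding kernel_E[OF le0 r, symmetric] by simp
  then have "\<forall>a\<in>W r 0. fourier a v = c * fourier a (\<lambda>_. 1)"
    by (simp only: fourier_diff_scale) simp
  then show ?F
    using fourier_trivial_one by metis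
next
  assume ?F
  then obtain c' where c': "\<forall>a\<in>W r 0. fourier a v = c'" by blast
  \<comment> \<open>The coefficients of the all-ones vector share one nonzero value, so a common
    value of the coefficients of \<open>v\<close> is a multiple of it.\<close>
  obtain c where c: "\<forall>a\<in>W r 0. fourier a v = c * fourier a (\<lambda>_. 1)"
  proof (cases "W r 0 = {}")
    case True
    then show ?thesis using that by blast
  next
    case False
    then obtain b where b: "b \<in> W r 0" by blast
    have "fourier a v = c' / fourier b (\<lambda>_. 1) * fourier a (\<lambda>_. 1)" if "a \<in> W r 0" for a
      using fourier_trivial_one[OF that b] fourier_trivial_one_nonzero[OF b] r c' that by simp
    then show ?thesis using that by blast
  qed
  let ?u = "\<lambda>y. v y - c * 1"
  have "\<forall>a\<in>W r 0. fourier a ?u = 0"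
    using c by (simp only: fourier_diff_scale) simp
  then have *: "\<forall>i. 0 \<le> i \<and> i \<le> r \<longrightarrow> (\<forall>x\<in>X. mat_vec X (E i 0) ?u x = 0)"
    unfolding kernel_E[OF le0 r] .
  show ?E
  proof (intro allI impI ballI)
    fix i x assume i: "0 < i \<and> i \<le> r" and x: "x \<in> X"
    have "(i, 0) \<in> L"
      using i r by (auto simp: johnson_index_def)
    then have "mat_vec X (E i 0) (\<lambda>_. 1) x = 0"
      using E_trivial_row_sum i x by blast
    moreover have "mat_vec X (E i 0) ?u x = 0"
      using * i x by simp
    ultimately show "mat_vec X (E i 0) v x = 0"
      by (simp only: mat_vec_vec_diff_scale) simp
  qed
qed

text \<open>\<open>T\<close> is treated column by column: for \<open>0 < j \<le> s\<close> the
  column is complete and \<open>kernel_E\<close> applies, while column 0 lacks \<open>(0, 0)\<close>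
  and needs \<open>kernel_E_trivial\<close>.\<close>

lemma design_iff_fourier:
  assumes rs: "(r, s) \<in> L" and r: "r \<le> min w (n - w)" and Y: "Y \<subseteq> X"
    and T: "T = {(i, j) \<in> L. i \<le> r \<and> j \<le> s} - {(0, 0)}"
  shows "is_design q n w E T Y \<longleftrightarrow>
    (\<forall>j. 0 < j \<and> j \<le> s \<longrightarrow> (\<forall>a\<in>W r j. fourier a (\<lambda>y. of_bool (y \<in> Y)) = 0)) \<and>
    (\<exists>c. \<forall>a\<in>W r 0. fourier a (\<lambda>y. of_bool (y \<in> Y)) = c)"
proof -
  let ?v = "\<lambda>y. if y \<in> Y then 1 else 0 :: complex"
  have v: "(\<lambda>y. of_bool (y \<in> Y)) = ?v"
    by auto
  have "s \<le> r"
    using rs by (simp add: johnson_index_def)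
  have "T \<subseteq> L - {(0, 0)}"
    unfolding T by blast
  then have "is_design q n w E T Y \<longleftrightarrow> (\<forall>i j. (i, j) \<in> T \<longrightarrow> (\<forall>x\<in>X. mat_vec X (E i j) ?v x = 0))"
    using Y unfolding is_design_def by blast
  \<comment> \<open>For \<open>i \<le> r\<close> the bound on \<open>r\<close> supplies the bounds
    on \<open>i\<close> and \<open>i - j\<close> in \<open>johnson_index\<close>.\<close>
  moreover have "(i, j) \<in> T \<longleftrightarrow> j \<le> i \<and> i \<le> r \<and> j \<le> s \<and> (i, j) \<noteq> (0, 0)" for i j
    using r unfolding T by (auto simp: johnson_index_def)
  ultimately have "is_design q n w E T Y \<longleftrightarrow>
    (\<forall>i j. j \<le> i \<and> i \<le> r \<and> j \<le> s \<and> (i, j) \<noteq> (0, 0) \<longrightarrow> (\<forall>x\<in>X. mat_vec X (E i j) ?v x = 0))"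
    by simp
  also have "\<dots> \<longleftrightarrow>
    (\<forall>j. 0 < j \<and> j \<le> s \<longrightarrow> (\<forall>i. j \<le> i \<and> i \<le> r \<longrightarrow> (\<forall>x\<in>X. mat_vec X (E i j) ?v x = 0))) \<and>
    (\<forall>i. 0 < i \<and> i \<le> r \<longrightarrow> (\<forall>x\<in>X. mat_vec X (E i 0) ?v x = 0))" (is "?A \<longleftrightarrow> ?B \<and> ?D")
  proof
    assume ?A
    then show "?B \<and> ?D" by simp
  next
    assume BD: "?B \<and> ?D"
    show ?A
    proof (intro allI impI)
      fix i j assume ij: "j \<le> i \<and> i \<le> r \<and> j \<le> s \<and> (i, j) \<noteq> (0, 0)"
      show "\<forall>x\<in>X. mat_vec X (E i j) ?v x = 0"
      proof (cases "j = 0")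
        case True
        then show ?thesis using BD ij by simp
      next
        case False
        then show ?thesis using BD ij by blast
      qed
    qed
  qed
  also have "?B \<longleftrightarrow> (\<forall>j. 0 < j \<and> j \<le> s \<longrightarrow> (\<forall>a\<in>W r j. fourier a ?v = 0))"
    using kernel_E[of _ r ?v] r \<open>s \<le> r\<close> by (meson order.trans)
  also have "?D \<longleftrightarrow> (\<exists>c. \<forall>a\<in>W r 0. fourier a ?v = c)"
    by (rule kernel_E_trivial[OF r])
  finally show ?thesis
    unfolding v .
qed

end

section \<open>Pattern counts\<close>

text \<open>Here the prescribed letters form a function on \<open>S\<close> instead of a list along
  its sorted elements, so patterns are the elements of the group of letter functions on
  \<open>S\<close>.\<close>

definition pattern_count :: "nat \<Rightarrow> word set \<Rightarrow> nat set \<Rightarrow> nat set \<Rightarrow> word \<Rightarrow> nat" where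
  "pattern_count n Y R S v = card {y \<in> Y. R \<subseteq> supp n y \<and> (\<forall>i\<in>S. y i = v i)}"

lemma m_count_eq_pattern_count:
  assumes "finite S" "\<And>j. j < card S \<Longrightarrow> v (sorted_list_of_set S ! j) = \<omega> ! j"
  shows "m_count n R S Y \<omega> = pattern_count n Y R S v"
proof -
  have "(\<forall>j<card S. y (sorted_list_of_set S ! j) = \<omega> ! j) \<longleftrightarrow> (\<forall>i\<in>S. y i = v i)" for y
  proof -
    have "(\<forall>i\<in>S. y i = v i) \<longleftrightarrow> (\<forall>i\<in>set (sorted_list_of_set S). y i = v i)"
      using assms(1) by simp
    also have "\<dots> \<longleftrightarrow> (\<forall>j<card S. y (sorted_list_of_set S ! j) = v (sorted_list_of_set S ! j))"
      unfolding all_set_conv_all_nth by simp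
    finally show ?thesis
      using assms(2) by simp
  qed
  then show ?thesis
    by (simp add: m_count_def pattern_count_def)
qed

section \<open>Fourier analysis of the pattern counts\<close>

context nonbinary_johnson
begin

lemma sum_prod_letters:
  assumes "finite S"
  shows "(\<Sum>v\<in>PiE S (\<lambda>_. letters). \<Prod>i\<in>S. f i (v i)) = (\<Prod>i\<in>S. \<Sum>c\<in>letters. f i c :: complex)"
  using assms by (subst prod_sum_PiE) auto

text \<open>Points whose support does not contain that of \<open>a\<close> contribute 0. For the
  others the letters outside \<open>S\<close> contribute factors 1, so grouping by the restriction
  to \<open>S\<close> gives the Fourier transform of the pattern counts.\<close>

lemma fourier_eq_pattern_counts:
  assumes Y: "Y \<subseteq> X" and a: "a \<in> words q n" and S: "nontriv a \<subseteq> S" "S \<subseteq> supp n a"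
  shows "fourier a (\<lambda>y. of_bool (y \<in> Y)) = (\<Sum>v\<in>PiE S (\<lambda>_. letters).
    of_nat (pattern_count n Y (supp n a) S v) * cnj (\<Prod>i\<in>S. \<psi> (a i) (v i)))"
proof -
  let ?V = "PiE S (\<lambda>_. letters)" and ?Y = "{y \<in> Y. supp n a \<subseteq> supp n y}"
  let ?g = "\<lambda>v. cnj (\<Prod>i\<in>S. \<psi> (a i) (v i))"
  have fin: "finite S" "finite Y"
    using finite_subset[OF S(2) finite_supp] finite_subset[OF Y finite_X] .
  have letter: "y i \<in> letters" if "y \<in> ?Y" "i \<in> supp n a" for y i
  proof -
    have "y \<in> X" "i \<in> supp n y"
      using that Y by blast+
    then show ?thesis
      by (intro word_letter) (simp_all only: in_X)
  qed
  have pairing: "pairing a y = (\<Prod>i\<in>S. \<psi> (a i) (y i))" if y: "y \<in> ?Y" for y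
    unfolding word_pairing_def
  proof (rule prod.mono_neutral_right)
    show "\<forall>i\<in>supp n a - S. \<psi> (a i) (y i) = 1"
    proof
      fix i assume i: "i \<in> supp n a - S"
      then have "a i = 1"
        using S by (auto simp: supp_def)
      then show "\<psi> (a i) (y i) = 1"
        using letter[OF y] i by simp
    qed
  qed (use S in auto)
  have "fourier a (\<lambda>y. of_bool (y \<in> Y)) = (\<Sum>y\<in>Y. cnj (pairing a y))"
    unfolding fourier_def using Y by (intro sum.mono_neutral_cong_right) auto
  also have "\<dots> = (\<Sum>y\<in>?Y. ?g (restrict y S))"
    using fin pairing_eq_0[OF a] by (intro sum.mono_neutral_cong_right) (auto simp: pairing)
  also have "\<dots> = (\<Sum>v\<in>?V. \<Sum>y\<in>{y \<in> ?Y. restrict y S = v}. ?g (restrict y S))"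
    using fin S letter by (intro sum.group[symmetric]) (auto simp: finite_PiE)
  also have "\<dots> = (\<Sum>v\<in>?V. of_nat (pattern_count n Y (supp n a) S v) * ?g v)"
  proof (intro sum.cong refl)
    fix v assume v: "v \<in> ?V"
    have "restrict y S = v \<longleftrightarrow> (\<forall>i\<in>S. y i = v i)" for y
      using v by (auto simp: fun_eq_iff PiE_def extensional_def restrict_def)
    then have "{y \<in> ?Y. restrict y S = v} = {y \<in> Y. supp n a \<subseteq> supp n y \<and> (\<forall>i\<in>S. y i = v i)}"
      by auto
    moreover have "(\<Sum>y\<in>{y \<in> ?Y. restrict y S = v}. ?g (restrict y S)) = of_nat (card {y \<in> ?Y. restrict y S = v}) * ?g v"
      by simp
    ultimately show "(\<Sum>y\<in>{y \<in> ?Y. restrict y S = v}. ?g (restrict y S)) =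
        of_nat (pattern_count n Y (supp n a) S v) * ?g v"
      by (simp only: pattern_count_def)
  qed
  finally show ?thesis .
qed

text \<open>Realises the character of the letter functions on \<open>S\<close> indexed by
  \<open>b\<close> as a word with support \<open>R\<close>, trivial outside
  \<open>S\<close>.\<close>

definition extend_word :: "nat set \<Rightarrow> nat set \<Rightarrow> word \<Rightarrow> word" where
  "extend_word R S b = (\<lambda>i. if i \<in> {1..n} then (if i \<in> S then b i else if i \<in> R then 1 else 0) else undefined)"

lemma extend_word:
  assumes "R \<subseteq> {1..n}" "S \<subseteq> R" "b \<in> PiE S (\<lambda>_. letters)"
  shows "extend_word R S b \<in> words q n" "supp n (extend_word R S b) = R"
    "nontriv (extend_word R S b) = {i \<in> S. b i \<noteq> 1}"
proof -
  have b: "b i < q" "b i \<noteq> 0" if "i \<in> S" for i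
    using PiE_mem[OF assms(3) that] by (auto simp: nonzero_letters_def)
  show "extend_word R S b \<in> words q n"
    using b q2 by (auto simp: words_def extend_word_def)
  show "supp n (extend_word R S b) = R"
    unfolding supp_def extend_word_def using assms(1,2) b by auto
  show "nontriv (extend_word R S b) = {i \<in> S. b i \<noteq> 1}"
    unfolding extend_word_def using assms(1,2) b by auto
qed

text \<open>Fourier inversion on the group of letter functions on \<open>S\<close>, whose order is
  the factor \<open>(q - 1) ^ card S\<close>. Orthogonality at each position of \<open>S\<close>
  leaves only the pattern \<open>u = v\<close>.\<close>

lemma pattern_count_inversion:
  assumes Y: "Y \<subseteq> X" and RS: "R \<subseteq> {1..n}" "S \<subseteq> R" and v: "v \<in> PiE S (\<lambda>_. letters)"
  shows "of_nat ((q - 1) ^ card S * pattern_count n Y R S v) =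
    (\<Sum>b\<in>PiE S (\<lambda>_. letters). (\<Prod>i\<in>S. \<psi> (b i) (v i)) * fourier (extend_word R S b) (\<lambda>y. of_bool (y \<in> Y)))"
proof -
  let ?V = "PiE S (\<lambda>_. letters)"
  have fin: "finite S" "finite ?V"
    using RS finite_subset[of S "{1..n}"] by (auto simp: finite_PiE)
  have f: "fourier (extend_word R S b) (\<lambda>y. of_bool (y \<in> Y)) =
      (\<Sum>u\<in>?V. of_nat (pattern_count n Y R S u) * cnj (\<Prod>i\<in>S. \<psi> (b i) (u i)))" if b: "b \<in> ?V" for b
  proof -
    note ext = extend_word[OF RS b]
    have "(\<Prod>i\<in>S. \<psi> (extend_word R S b i) (u i)) = (\<Prod>i\<in>S. \<psi> (b i) (u i))" for u
      using RS by (intro prod.cong refl) (auto simp: extend_word_def)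
    moreover have "fourier (extend_word R S b) (\<lambda>y. of_bool (y \<in> Y)) = (\<Sum>u\<in>?V.
        of_nat (pattern_count n Y (supp n (extend_word R S b)) S u) * cnj (\<Prod>i\<in>S. \<psi> (extend_word R S b i) (u i)))"
      by (rule fourier_eq_pattern_counts[OF Y ext(1)]) (use RS(2) in \<open>simp_all only: ext(2,3), auto\<close>)
    ultimately show ?thesis
      by (simp only: ext(2))
  qed
  have "(\<Sum>b\<in>?V. (\<Prod>i\<in>S. \<psi> (b i) (v i)) * fourier (extend_word R S b) (\<lambda>y. of_bool (y \<in> Y))) =
    (\<Sum>b\<in>?V. \<Sum>u\<in>?V. of_nat (pattern_count n Y R S u) * (\<Prod>i\<in>S. \<psi> (b i) (v i) * cnj (\<psi> (b i) (u i))))"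
    by (intro sum.cong refl) (simp add: f sum_distrib_left prod.distrib mult_ac)
  also have "\<dots> = (\<Sum>u\<in>?V. of_nat (pattern_count n Y R S u) * (\<Prod>i\<in>S. \<Sum>c\<in>letters. \<psi> c (v i) * cnj (\<psi> c (u i))))"
    by (subst sum.swap) (simp add: sum_distrib_left flip: sum_prod_letters[OF fin(1)])
  also have "\<dots> = (\<Sum>u\<in>?V. if u = v then of_nat (pattern_count n Y R S v) * of_nat (q - 1) ^ card S else 0)"
  proof (intro sum.cong refl)
    fix u assume u: "u \<in> ?V"
    have uv: "u i \<in> letters" "v i \<in> letters" if "i \<in> S" for i
      using that u v by auto
    have prod: "(\<Prod>i\<in>S. \<Sum>c\<in>letters. \<psi> c (v i) * cnj (\<psi> c (u i))) =
        (\<Prod>i\<in>S. if v i = u i then of_nat (q - 1) else 0)"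
      using uv by (intro prod.cong refl) (simp only: char_orthogonal_dual)
    show "of_nat (pattern_count n Y R S u) * (\<Prod>i\<in>S. \<Sum>c\<in>letters. \<psi> c (v i) * cnj (\<psi> c (u i))) =
      (if u = v then of_nat (pattern_count n Y R S v) * of_nat (q - 1) ^ card S else 0)"
    proof (cases "u = v")
      case True
      then show ?thesis unfolding prod by simp
    next
      case False
      then obtain i where i: "i \<in> S" "u i \<noteq> v i"
        using PiE_ext[OF u v] by blast
      then have "(\<Prod>i\<in>S. if v i = u i then of_nat (q - 1) else 0) = (0 :: complex)"
        using fin(1) by (intro prod_zero bexI[of _ i]) auto
      then show ?thesis unfolding prod using False by simp
    qed
  qed
  also have "\<dots> = of_nat ((q - 1) ^ card S * pattern_count n Y R S v)"
    using fin v by (simp add: mult.commute)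
  finally show ?thesis by simp
qed

text \<open>The nontrivial positions of \<open>a\<close> are enlarged to a set \<open>S\<close> of
  size \<open>s\<close> inside its support. Constant counts make the transform a product of full
  character sums over \<open>S\<close>, and one nontrivial character makes it vanish.\<close>

lemma pattern_count_const_imp_fourier:
  assumes Y: "Y \<subseteq> X" and a: "a \<in> W r j" and js: "j \<le> s" "s \<le> r"
    and const: "\<And>R S v. R \<subseteq> {1..n} \<Longrightarrow> S \<subseteq> R \<Longrightarrow> card R = r \<Longrightarrow> card S = s \<Longrightarrow>
      v \<in> PiE S (\<lambda>_. letters) \<Longrightarrow> pattern_count n Y R S v = c"
  shows "fourier a (\<lambda>y. of_bool (y \<in> Y)) = (if j = 0 then of_nat (c * (q - 1) ^ s) else 0)"
proof -
  have aw: "a \<in> words q n" "card (supp n a) = r" "card (nontriv a) = j"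
    using a by (simp_all only: in_W)
  have sub: "nontriv a \<subseteq> supp n a" "supp n a \<subseteq> {1..n}"
    by (auto simp: supp_def)
  have "\<exists>S. nontriv a \<subseteq> S \<and> S \<subseteq> supp n a \<and> card S = s"
    using js aw sub by (intro exists_subset_between) simp_all
  then obtain S where S: "nontriv a \<subseteq> S" "S \<subseteq> supp n a" "card S = s"
    by blast
  have fin: "finite S"
    using finite_subset[OF S(2) finite_supp] .
  have "fourier a (\<lambda>y. of_bool (y \<in> Y)) =
      (\<Sum>v\<in>PiE S (\<lambda>_. letters). of_nat c * (\<Prod>i\<in>S. cnj (\<psi> (a i) (v i))))"
    unfolding fourier_eq_pattern_counts[OF Y aw(1) S(1,2)]
    by (intro sum.cong refl) (simp add: const[OF sub(2) S(2) aw(2) S(3)])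
  also have "\<dots> = of_nat c * (\<Prod>i\<in>S. cnj (\<Sum>b\<in>letters. \<psi> (a i) b))"
    using sum_prod_letters[OF fin, of "\<lambda>i x. cnj (\<psi> (a i) x)"] by (simp flip: sum_distrib_left)
  also have "(\<Prod>i\<in>S. cnj (\<Sum>b\<in>letters. \<psi> (a i) b)) = (\<Prod>i\<in>S. if a i = 1 then of_nat (q - 1) else 0)"
  proof (intro prod.cong refl)
    fix i assume "i \<in> S"
    then have "a i \<in> letters"
      using S(2) word_letter[OF aw(1)] by blast
    then show "cnj (\<Sum>b\<in>letters. \<psi> (a i) b) = (if a i = 1 then of_nat (q - 1) else 0)"
      by (subst sum_char) simp_all
  qed
  also have "of_nat c * \<dots> = (if j = 0 then of_nat (c * (q - 1) ^ s) else 0)"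
  proof (cases "j = 0")
    case True
    then have "nontriv a = {}"
      using aw(3) by simp
    then have "a i = 1" if "i \<in> S" for i
      using that S(2) unfolding supp_def by blast
    then have "(\<Prod>i\<in>S. if a i = 1 then of_nat (q - 1) else 0) = (of_nat (q - 1) ^ s :: complex)"
      using S(3) by simp
    then show ?thesis using True by simp
  next
    case False
    then have "nontriv a \<noteq> {}"
      using aw(3) by (metis card.empty)
    then obtain i where i: "i \<in> S" "a i \<noteq> 1"
      using S(1) by blast
    then have "(\<Prod>i\<in>S. if a i = 1 then of_nat (q - 1) else 0) = (0 :: complex)"
      using fin by (intro prod_zero bexI[of _ i]) auto
    then show ?thesis using False by simp
  qed
  finally show ?thesis .
qed

text \<open>In the inversion formula every \<open>b\<close> other than the trivial pattern gives a
  word in \<open>W r j\<close> with \<open>0 < j \<le> s\<close>, whose coefficient is zero. Only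
  the term \<open>c\<close> survives.\<close>

lemma fourier_imp_pattern_count_const:
  assumes Y: "Y \<subseteq> X"
    and nontriv: "\<And>j a. 0 < j \<Longrightarrow> j \<le> s \<Longrightarrow> a \<in> W r j \<Longrightarrow> fourier a (\<lambda>y. of_bool (y \<in> Y)) = 0"
    and triv: "\<And>a. a \<in> W r 0 \<Longrightarrow> fourier a (\<lambda>y. of_bool (y \<in> Y)) = c"
    and RS: "R \<subseteq> {1..n}" "S \<subseteq> R" "card R = r" "card S = s" and v: "v \<in> PiE S (\<lambda>_. letters)"
  shows "of_nat ((q - 1) ^ s * pattern_count n Y R S v) = c"
proof -
  let ?V = "PiE S (\<lambda>_. letters)"
  let ?one = "restrict (\<lambda>_. 1) S"
  have fin: "finite S" "finite ?V"
    using RS finite_subset[of S "{1..n}"] by (auto simp: finite_PiE)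
  have one: "?one \<in> ?V"
    by auto
  have W: "extend_word R S b \<in> W r (card {i \<in> S. b i \<noteq> 1})" if "b \<in> ?V" for b
    using extend_word[OF RS(1,2) that] RS(3) by (simp only: in_W simp_thms)
  have "of_nat ((q - 1) ^ s * pattern_count n Y R S v) =
    (\<Sum>b\<in>?V. (\<Prod>i\<in>S. \<psi> (b i) (v i)) * fourier (extend_word R S b) (\<lambda>y. of_bool (y \<in> Y)))"
    using pattern_count_inversion[OF Y RS(1,2) v] RS(4) by simp
  also have "\<dots> = (\<Sum>b\<in>?V. if b = ?one then c else 0)"
  proof (intro sum.cong refl)
    fix b assume b: "b \<in> ?V"
    show "(\<Prod>i\<in>S. \<psi> (b i) (v i)) * fourier (extend_word R S b) (\<lambda>y. of_bool (y \<in> Y)) = (if b = ?one then c else 0)"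
    proof (cases "b = ?one")
      case True
      have "(\<Prod>i\<in>S. \<psi> (b i) (v i)) = 1"
        using PiE_mem[OF v] True by (intro prod.neutral) simp
      moreover have "{i \<in> S. b i \<noteq> 1} = {}"
        using True by auto
      then have "extend_word R S b \<in> W r 0"
        using W[OF b] by (simp only: card.empty)
      then have "fourier (extend_word R S b) (\<lambda>y. of_bool (y \<in> Y)) = c"
        by (rule triv)
      ultimately show ?thesis using True by simp
    next
      case False
      then obtain i where "i \<in> S" "b i \<noteq> 1"
        using PiE_ext[OF b one] by auto
      then have "card {i \<in> S. b i \<noteq> 1} > 0"
        using fin(1) by (auto simp: card_gt_0_iff)
      moreover have "card {i \<in> S. b i \<noteq> 1} \<le> s"
        using fin(1) RS(4) by (auto intro: card_mono)
      ultimately have "fourier (extend_word R S b) (\<lambda>y. of_bool (y \<in> Y)) = 0"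
        using nontriv W[OF b] by blast
      then show ?thesis using False by simp
    qed
  qed
  also have "\<dots> = c"
    using fin one by simp
  finally show ?thesis .
qed

lemma m_count_const_iff:
  "(\<forall>R S \<omega>. R \<subseteq> {1..n} \<and> S \<subseteq> R \<and> card R = r \<and> card S = s \<and>
      length \<omega> = s \<and> set \<omega> \<subseteq> letters \<longrightarrow> m_count n R S Y \<omega> = c) \<longleftrightarrow>
    (\<forall>R S v. R \<subseteq> {1..n} \<and> S \<subseteq> R \<and> card R = r \<and> card S = s \<and> v \<in> PiE S (\<lambda>_. letters) \<longrightarrow>
      pattern_count n Y R S v = c)" (is "?M \<longleftrightarrow> ?P")
proof
  assume M: ?M
  show ?P
  proof (intro allI impI)
    fix R S v assume *: "R \<subseteq> {1..n} \<and> S \<subseteq> R \<and> card R = r \<and> card S = s \<and> v \<in> PiE S (\<lambda>_. letters)"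
    then have fin: "finite S"
      using finite_subset[of S "{1..n}"] by auto
    let ?\<omega> = "map v (sorted_list_of_set S)"
    have "m_count n R S Y ?\<omega> = pattern_count n Y R S v"
      using fin by (intro m_count_eq_pattern_count) auto
    moreover have "set ?\<omega> \<subseteq> letters" "length ?\<omega> = s"
      using * fin by auto
    ultimately show "pattern_count n Y R S v = c"
      using M * by metis
  qed
next
  assume P: ?P
  show ?M
  proof (intro allI impI)
    fix R S \<omega> assume *: "R \<subseteq> {1..n} \<and> S \<subseteq> R \<and> card R = r \<and> card S = s \<and> length \<omega> = s \<and> set \<omega> \<subseteq> letters"
    then have fin: "finite S"
      using finite_subset[of S "{1..n}"] by auto
    let ?l = "sorted_list_of_set S"
    \<comment> \<open>The list read as a function by zipping it with the increasing enumeration of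
      \<open>S\<close>.\<close>
    define v where "v = restrict (\<lambda>i. the (map_of (zip ?l \<omega>) i)) S"
    have v: "v (?l ! j) = \<omega> ! j" if "j < card S" for j
    proof -
      have "?l ! j \<in> S"
        using that fin nth_mem[of j ?l] by simp
      then show ?thesis
        using that * map_of_zip_nth[of ?l \<omega> j] by (simp add: v_def)
    qed
    have "v i \<in> letters" if i: "i \<in> S" for i
    proof -
      obtain j where "j < card S" "i = ?l ! j"
        using i fin in_set_conv_nth[of i ?l] by auto
      then show ?thesis
        using v * nth_mem[of j \<omega>] by auto
    qed
    then have "v \<in> PiE S (\<lambda>_. letters)"
      by (auto simp: v_def)
    then have "pattern_count n Y R S v = c"
      using P * by blast
    then show "m_count n R S Y \<omega> = c"
      using m_count_eq_pattern_count[OF fin v] by simp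
  qed
qed

end

section \<open>Designs and constant counts\<close>

context nonbinary_johnson_idempotents
begin

lemma design_iff_m_count_const:
  assumes rs: "(r, s) \<in> L" and r: "r \<le> min w (n - w)" and Y: "Y \<subseteq> X"
    and T: "T = {(i, j) \<in> L. i \<le> r \<and> j \<le> s} - {(0, 0)}"
  shows "is_design q n w E T Y \<longleftrightarrow>
    (\<exists>c. \<forall>R S \<omega>. R \<subseteq> {1..n} \<and> S \<subseteq> R \<and> card R = r \<and> card S = s \<and>
      length \<omega> = s \<and> set \<omega> \<subseteq> letters \<longrightarrow> m_count n R S Y \<omega> = c)"
  unfolding design_iff_fourier[OF assms] m_count_const_iff
proof
  have "s \<le> r"
    using rs by (simp add: johnson_index_def)
  assume "\<exists>c. \<forall>R S v. R \<subseteq> {1..n} \<and> S \<subseteq> R \<and> card R = r \<and> card S = s \<and> v \<in> PiE S (\<lambda>_. letters) \<longrightarrow>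
    pattern_count n Y R S v = c"
  then obtain c where "\<forall>R S v. R \<subseteq> {1..n} \<and> S \<subseteq> R \<and> card R = r \<and> card S = s \<and>
      v \<in> PiE S (\<lambda>_. letters) \<longrightarrow> pattern_count n Y R S v = c"
    by (rule exE)
  then have c: "pattern_count n Y R S v = c"
    if "R \<subseteq> {1..n}" "S \<subseteq> R" "card R = r" "card S = s" "v \<in> PiE S (\<lambda>_. letters)" for R S v
    using that by blast
  have f: "fourier a (\<lambda>y. of_bool (y \<in> Y)) = (if j = 0 then of_nat (c * (q - 1) ^ s) else 0)"
    if "a \<in> W r j" "j \<le> s" for a j
    by (rule pattern_count_const_imp_fourier[OF Y that \<open>s \<le> r\<close>]) (rule c)
  show "(\<forall>j. 0 < j \<and> j \<le> s \<longrightarrow> (\<forall>a\<in>W r j. fourier a (\<lambda>y. of_bool (y \<in> Y)) = 0)) \<and>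
    (\<exists>c. \<forall>a\<in>W r 0. fourier a (\<lambda>y. of_bool (y \<in> Y)) = c)"
  proof (intro conjI allI impI ballI exI)
    fix j a assume "0 < j \<and> j \<le> s" "a \<in> W r j"
    then show "fourier a (\<lambda>y. of_bool (y \<in> Y)) = 0"
      using f[of a j] by simp
  next
    fix a assume "a \<in> W r 0"
    then show "fourier a (\<lambda>y. of_bool (y \<in> Y)) = of_nat (c * (q - 1) ^ s)"
      using f[of a 0] by simp
  qed
next
  assume F: "(\<forall>j. 0 < j \<and> j \<le> s \<longrightarrow> (\<forall>a\<in>W r j. fourier a (\<lambda>y. of_bool (y \<in> Y)) = 0)) \<and>
    (\<exists>c. \<forall>a\<in>W r 0. fourier a (\<lambda>y. of_bool (y \<in> Y)) = c)"
  then obtain c where c: "\<forall>a\<in>W r 0. fourier a (\<lambda>y. of_bool (y \<in> Y)) = c"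
    by blast
  have count: "of_nat ((q - 1) ^ s * pattern_count n Y R S v) = c"
    if "R \<subseteq> {1..n}" "S \<subseteq> R" "card R = r" "card S = s" "v \<in> PiE S (\<lambda>_. letters)" for R S v
    by (rule fourier_imp_pattern_count_const[OF Y _ _ that]) (use F c in blast)+
  \<comment> \<open>All counts satisfy one equation whose solution \<open>m\<close> is unique, since
    \<open>(q - 1) ^ s\<close> is nonzero. If the complex number \<open>c\<close> admits no
    solution, any \<open>d\<close> serves.\<close>
  have "\<exists>d. \<forall>m. of_nat ((q - 1) ^ s * m) = c \<longrightarrow> m = d"
  proof (cases "\<exists>d. of_nat ((q - 1) ^ s * d) = c")
    case True
    then obtain d where d: "of_nat ((q - 1) ^ s * d) = c" by blast
    have "m = d" if m: "of_nat ((q - 1) ^ s * m) = c" for m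
    proof -
      have "(q - 1) ^ s * m = (q - 1) ^ s * d"
        using m d by (metis of_nat_eq_iff)
      then show ?thesis using q2 by simp
    qed
    then show ?thesis by blast
  qed auto
  then obtain d where d: "\<And>m. of_nat ((q - 1) ^ s * m) = c \<Longrightarrow> m = d"
    by blast
  show "\<exists>c. \<forall>R S v. R \<subseteq> {1..n} \<and> S \<subseteq> R \<and> card R = r \<and> card S = s \<and> v \<in> PiE S (\<lambda>_. letters) \<longrightarrow>
      pattern_count n Y R S v = c"
  proof (intro exI[of _ d] allI impI, elim conjE)
    fix R S v
    assume "R \<subseteq> {1..n}" "S \<subseteq> R" "card R = r" "card S = s" "v \<in> PiE S (\<lambda>_. letters)"
    then show "pattern_count n Y R S v = d"
      by (rule d[OF count])
  qed
qed

end

theorem theorem3p2: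
  fixes q n w r s :: nat
    and G :: "nat monoid"
    and \<psi> :: "nat \<Rightarrow> nat \<Rightarrow> complex"
    and E :: "nat \<Rightarrow> nat \<Rightarrow> word_mat"
    and Y :: "word set"
    and T :: "(nat \<times> nat) set"
  assumes "q \<ge> 3" and "n \<ge> 1" and "w \<le> n"
    and "symmetric_characters q G \<psi>"
    and "indexed_idempotents q n w \<psi> E"
    and "(r, s) \<in> johnson_index n w" and "(r, s) \<noteq> (0, 0)"
    and "r \<le> min w (n - w)"
    and "T = {(i, j) \<in> johnson_index n w. i \<le> r \<and> j \<le> s} - {(0, 0)}"
    and "Y \<subseteq> johnson_points q n w"
  shows "is_design q n w E T Y \<longleftrightarrow>
    (\<exists>c. \<forall>R S \<omega>. R \<subseteq> {1..n} \<and> S \<subseteq> R \<and> card R = r \<and> card S = s \<and>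
        length \<omega> = s \<and> set \<omega> \<subseteq> nonzero_letters q \<longrightarrow>
        m_count n R S Y \<omega> = c)"
proof -
  interpret nonbinary_johnson_idempotents q n w G \<psi> E
    using assms(1,3,4,5) by unfold_locales simp_all
  show ?thesis
    by (rule design_iff_m_count_const[OF assms(6,8,10,9)])
qed

end
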